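(* Let $\bar p=(\bar p_1,\dots,\bar p_n)$ be a probability distribution on $n$ outcomes with $\bar p_i>0$ for all $i$, and let $\alpha\in(0,1)$ be fixed. For each $N$, let $N$ data be drawn independently from $\bar p$, let $N_i$ be the number of observations of outcome $i$ (so $\sum_{i=1}^n N_i=N$), and let $\gamma_N$ be the (random) number, depending on $(N_1,\dots,N_n)$, such that $$\mathbb{P}_{\mathbf N}\big(p\in\mathbb{D}(\gamma_N)\big)=1-\alpha,$$ where $$\mathbb{D}(\gamma)=\Big\{p=(p_1,\dots,p_n)\ \Big|\ \sum_{i=1}^n N_i\log p_i\ge\gamma,\ \sum_{i=1}^n p_i=1,\ p_i\ge 0,\ i=1,\dots,n\Big\}$$ and $\mathbb{P}_{\mathbf N}$ is the Dirichlet probability measure on $p$ with parameters $N_1,\dots,N_n$. Then, as $N\to\infty$, $$\sqrt{N}\left(\frac{\gamma_N}{N}-\sum_{i=1}^n\bar p_i\log\bar p_i\right)\Rightarrow_d X_0,$$ where $X_0=\sum_{i=1}^n(1+\log\bar p_i)X_i$ with $(X_1,\dots,X_n)\sim N(0,\Sigma)$ and $$\Sigma=\begin{pmatrix}\bar p_1(1-\bar p_1)&-\bar p_1\bar p_2&\cdots&-\bar p_1\bar p_n\\ -\bar p_1\bar p_2&\bar p_2(1-\bar p_2)&\cdots&-\bar p_2\bar p_n\\ \vdots&\vdots&\ddots&\vdots\\ -\bar p_1\bar p_n&-\bar p_2\bar p_n&\cdots&\bar p_n(1-\bar p_n)\end{pmatrix}.$$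
   Context: $\Rightarrow_d$ denotes convergence in distribution. $N(0,\Sigma)$ is the (possibly degenerate) multivariate normal distribution with mean $0$ and covariance $\Sigma$. The Dirichlet distribution with parameters $N_1,\dots,N_n>0$ is the probability measure on the simplex $\Delta=\{p\mid p_1+\cdots+p_n=1,\ p_i\ge 0\}$ with density $$f(p)=\frac{\Gamma(\sum_{i=1}^n N_i)}{\prod_{i=1}^n\Gamma(N_i)}\prod_{i=1}^n p_i^{N_i-1}.$$ The quantity $\gamma_N$ is defined on the event that all $N_i>0$, whose probability tends to $1$ as $N\to\infty$; its value off this event is irrelevant to the limit. *)

theory Defs
  imports "HOL-Probability.Probability"
begin

text \<open>
  The outcomes are \<open>1, \<dots>, n\<close>. Vectors in \<open>n\<close>-space are functions \<^typ>\<open>nat \<Rightarrow> real\<close> that are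
  \<^const>\<open>undefined\<close> outside \<open>{1..n}\<close>, i.e. the points of \<open>\<Pi>\<^sub>M i\<in>{1..n}. borel\<close>.
\<close>

definition simplex_pts :: "nat \<Rightarrow> (nat \<Rightarrow> real) set" where
  "simplex_pts n = {p \<in> extensional {1..n}. (\<Sum>i=1..n. p i) = 1 \<and> (\<forall>i\<in>{1..n}. p i \<ge> 0)}"

text \<open>
  A density on the simplex is taken with respect to Lebesgue measure in the first \<open>n - 1\<close>
  coordinates; this is the reference measure for which the Gamma-function constant below normalizes
  the Dirichlet density. Here that measure is carried by the whole hyperplane of coordinate sum 1.
\<close>

definition hyperplane_lebesgue :: "nat \<Rightarrow> (nat \<Rightarrow> real) measure" where
  "hyperplane_lebesgue n =
     distr (\<Pi>\<^sub>M i\<in>{1..<n}. lborel) (\<Pi>\<^sub>M i\<in>{1..n}. borel)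
       (\<lambda>q. \<lambda>i\<in>{1..n}. if i < n then q i else 1 - (\<Sum>j=1..<n. q j))"

text \<open>
  Since \<^prop>\<open>(0::real) powr a = 0\<close> for every \<open>a\<close>, the density vanishes on the boundary of the
  simplex, which is a null set of the reference measure.
\<close>

definition dirichlet_density :: "nat \<Rightarrow> (nat \<Rightarrow> real) \<Rightarrow> (nat \<Rightarrow> real) \<Rightarrow> real" where
  "dirichlet_density n a p =
     Gamma (\<Sum>i=1..n. a i) / (\<Prod>i=1..n. Gamma (a i)) * (\<Prod>i=1..n. p i powr (a i - 1))"

definition dirichlet :: "nat \<Rightarrow> (nat \<Rightarrow> real) \<Rightarrow> (nat \<Rightarrow> real) measure" where
  "dirichlet n a =
     density (hyperplane_lebesgue n)
       (\<lambda>p. ennreal (dirichlet_density n a p * indicator (simplex_pts n) p))"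

text \<open>The real-valued \<^const>\<open>ln\<close> satisfies \<^prop>\<open>ln (0::real) = 0\<close>; the likelihood needs
  \<open>log 0 = -\<infinity>\<close>.\<close>

definition elog :: "real \<Rightarrow> ereal" where
  "elog x = (if x > 0 then ereal (ln x) else -\<infinity>)"

definition likelihood_region :: "nat \<Rightarrow> (nat \<Rightarrow> nat) \<Rightarrow> real \<Rightarrow> (nat \<Rightarrow> real) set" where
  "likelihood_region n c \<gamma> =
     {p \<in> simplex_pts n. (\<Sum>i=1..n. ereal (real (c i)) * elog (p i)) \<ge> ereal \<gamma>}"

definition counts :: "nat \<Rightarrow> (nat \<Rightarrow> 'a \<Rightarrow> nat) \<Rightarrow> 'a \<Rightarrow> nat \<Rightarrow> nat" where
  "counts N X \<omega> i = card {k \<in> {1..N}. X k \<omega> = i}"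

text \<open>
  \<open>(Y\<^sub>1, \<dots>, Y\<^sub>n)\<close> has the law of \<open>m + A Z\<close> for a vector \<open>Z\<close> of \<open>k\<close> independent standard normal
  variables and an \<open>n \<times> k\<close> matrix \<open>A\<close> with \<open>A A\<^sup>T = S\<close>; \<open>S\<close> may be singular.
\<close>

definition multivariate_normal ::
    "'a measure \<Rightarrow> nat \<Rightarrow> (nat \<Rightarrow> 'a \<Rightarrow> real) \<Rightarrow> (nat \<Rightarrow> real) \<Rightarrow> (nat \<Rightarrow> nat \<Rightarrow> real) \<Rightarrow> bool" where
  "multivariate_normal M n Y m S \<longleftrightarrow>
     (\<forall>i\<in>{1..n}. Y i \<in> borel_measurable M) \<and>
     (\<exists>k (A :: nat \<Rightarrow> nat \<Rightarrow> real).
        (\<forall>i\<in>{1..n}. \<forall>j\<in>{1..n}. (\<Sum>l=1..k. A i l * A j l) = S i j) \<and>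
        distr M (\<Pi>\<^sub>M i\<in>{1..n}. borel) (\<lambda>\<omega>. \<lambda>i\<in>{1..n}. Y i \<omega>) =
        distr (\<Pi>\<^sub>M l\<in>{1..k}. std_normal_distribution) (\<Pi>\<^sub>M i\<in>{1..n}. borel)
          (\<lambda>z. \<lambda>i\<in>{1..n}. m i + (\<Sum>l=1..k. A i l * z l)))"

definition multinomial_cov :: "(nat \<Rightarrow> real) \<Rightarrow> nat \<Rightarrow> nat \<Rightarrow> real" where
  "multinomial_cov p i j = (if i = j then p i * (1 - p i) else - (p i * p j))"

end

theory Submission
  imports Defs
begin

text \<open>
  Write \<open>q\<^sub>i = N\<^sub>i / N\<close> and \<open>h p = \<Sum>i. p\<^sub>i ln p\<^sub>i\<close>. The likelihood is maximal at \<open>q\<close>, so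
  \<open>\<gamma>\<^sub>N \<le> N h q\<close>. Conversely \<open>N h q - \<Sum>i. N\<^sub>i ln p\<^sub>i \<le> \<Sum>i. N q\<^sub>i\<^sup>2 / p\<^sub>i - N\<close> by \<open>ln x \<le> x - 1\<close>, and the
  Dirichlet mean \<open>(N - 1) / (N\<^sub>i - 1)\<close> of \<open>1 / p\<^sub>i\<close> bounds the expectation of the right-hand side
  by \<open>2 n\<close>; Markov's inequality then gives \<open>\<gamma>\<^sub>N \<ge> N h q - 2 n / \<alpha>\<close>. Hence \<open>\<gamma>\<^sub>N / N\<close> may be
  replaced by \<open>h q\<close>. Finally \<open>h q - h pbar\<close> is the linear statistic
  \<open>\<Sum>i. (q\<^sub>i - pbar\<^sub>i) ln pbar\<^sub>i\<close> plus a relative entropy, which lies between \<open>0\<close> and the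
  chi-square distance, whose mean is at most \<open>n / N\<close>. The linear statistic obeys the central limit
  theorem.
\<close>

section \<open>The Dirichlet distribution\<close>

text \<open>The substitution \<open>x = s * t\<close> reduces to Euler's Beta integral; the two
  powers of \<open>s\<close> and the Jacobian combine to \<open>s powr (a + b - 1)\<close>. At
  \<open>s = 0\<close> both sides vanish, because \<open>0 powr _ = 0\<close>.\<close>

lemma nn_integral_Beta_scaled:
  fixes a b s :: real
  assumes "a > 0" "b > 0" "s \<ge> 0"
  shows "(\<integral>\<^sup>+x. ennreal (x powr (a - 1) * (s - x) powr (b - 1) * indicator {0..s} x) \<partial>lborel)
    = ennreal (s powr (a + b - 1) * Beta a b)"
proof (cases "s = 0")
  case True
  then show ?thesis by (auto simp: indicator_def intro!: nn_integral_zero' AE_I2)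
next
  case False
  with assms have s: "s > 0" by simp
  let ?f = "\<lambda>x. x powr (a - 1) * (s - x) powr (b - 1) * indicator {0..s} x"
  have 1: "(\<integral>\<^sup>+t. ennreal (indicator {0..1} t * (t powr (a - 1) * (1 - t) powr (b - 1))) \<partial>lborel)
      = ennreal (Beta a b)"
    using nn_integral_has_integral_lebesgue[OF _ has_integral_Beta_real[OF assms(1,2)]] by simp
  have "(\<integral>\<^sup>+x. ennreal (?f x) \<partial>lborel) = ennreal s * (\<integral>\<^sup>+t. ennreal (?f (0 + s * t)) \<partial>lborel)"
    using s by (subst nn_integral_real_affine[where c = s and t = 0]) (auto simp: ennreal_mult)
  also have "(\<integral>\<^sup>+t. ennreal (?f (0 + s * t)) \<partial>lborel)
      = (\<integral>\<^sup>+t. ennreal (s powr (a + b - 2)) *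
          ennreal (indicator {0..1} t * (t powr (a - 1) * (1 - t) powr (b - 1))) \<partial>lborel)"
  proof (intro nn_integral_cong)
    fix t :: real
    have ind: "indicator {0..s} (0 + s * t) = (indicator {0..1} t :: real)"
      using s by (auto simp: indicator_def zero_le_mult_iff mult_le_cancel_left1)
    show "ennreal (?f (0 + s * t)) = ennreal (s powr (a + b - 2)) *
        ennreal (indicator {0..1} t * (t powr (a - 1) * (1 - t) powr (b - 1)))"
    proof (cases "t \<in> {0..1}")
      case True
      have "s - s * t = s * (1 - t)" by (simp add: algebra_simps)
      moreover have "s powr (a + b - 2) = s powr (a - 1) * s powr (b - 1)"
        by (simp add: powr_add[symmetric])
      ultimately show ?thesis using True s ind
        by (simp add: powr_mult ennreal_mult[symmetric] mult_ac)
    qed (use ind in simp)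
  qed
  also have "\<dots> = ennreal (s powr (a + b - 2)) * ennreal (Beta a b)"
    by (subst nn_integral_cmult) (auto simp: 1)
  also have "ennreal s * \<dots> = ennreal (s powr (a + b - 1) * Beta a b)"
  proof -
    have "s powr (a + b - 1) = s powr (1 + (a + b - 2))" by simp
    also have "\<dots> = s * s powr (a + b - 2)" using s by (subst powr_add) simp
    finally show ?thesis using s
      by (simp add: ennreal_mult'[symmetric] mult.assoc)
  qed
  finally show ?thesis .
qed

text \<open>Dirichlet's integral over a solid simplex of size \<open>s\<close>, with
  \<open>b\<close> governing the slack \<open>s - sum q I\<close>. Splitting off one coordinate
  \<open>y\<close> leaves the same integral over a simplex of size \<open>s - y\<close>, so the
  induction has to range over all \<open>s\<close>; what remains is a scaled Beta integral.\<close>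

lemma nn_integral_Dirichlet:
  fixes a :: "'i \<Rightarrow> real" and b s :: real
  assumes "finite I" "\<And>i. i \<in> I \<Longrightarrow> a i > 0" "b > 0" "s \<ge> 0"
  shows "(\<integral>\<^sup>+q. ennreal ((\<Prod>i\<in>I. q i powr (a i - 1)) * (s - sum q I) powr (b - 1) *
             indicator {q. (\<forall>i\<in>I. 0 \<le> q i) \<and> sum q I \<le> s} q) \<partial>(\<Pi>\<^sub>M i\<in>I. lborel))
    = ennreal (s powr (sum a I + b - 1) * ((\<Prod>i\<in>I. Gamma (a i)) * Gamma b / Gamma (sum a I + b)))"
  using assms
proof (induction I arbitrary: s rule: finite_induct)
  case empty
  interpret product_sigma_finite "\<lambda>_::'i. lborel :: real measure" ..
  have "Gamma b \<noteq> 0" using Gamma_real_pos[OF empty(2)] by simp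
  then show ?case using empty by (simp add: product_nn_integral_singleton nn_integral_empty PiM_empty indicator_def)
next
  case (insert j I)
  interpret product_sigma_finite "\<lambda>_::'i. lborel :: real measure" ..
  let ?f = "\<lambda>I s q. (\<Prod>i\<in>I. q i powr (a i - 1)) * (s - sum q I) powr (b - 1) *
             indicator {q. (\<forall>i\<in>I. 0 \<le> q i) \<and> sum q I \<le> s} q"
  let ?C = "(\<Prod>i\<in>I. Gamma (a i)) * Gamma b / Gamma (sum a I + b)"
  have aj: "a j > 0" and sa: "sum a I + b > 0" and C0: "?C \<ge> 0"
    using insert.prems insert.hyps
    by (auto intro!: add_nonneg_pos sum_nonneg divide_nonneg_pos mult_nonneg_nonneg prod_nonneg Gamma_real_pos
        simp: less_imp_le Gamma_real_pos)
  have meas: "(\<lambda>q. ennreal (?f K u q)) \<in> borel_measurable (\<Pi>\<^sub>M i\<in>K. lborel)" if K: "finite K" for K u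
  proof -
    have [measurable]: "(\<lambda>q. q i) \<in> borel_measurable (\<Pi>\<^sub>M i\<in>K. (lborel :: real measure))" if "i \<in> K" for i
      using measurable_component_singleton[OF that, of "\<lambda>_. lborel"] by simp
    have "{q \<in> space (\<Pi>\<^sub>M i\<in>K. (lborel :: real measure)). (\<forall>i\<in>K. 0 \<le> q i) \<and> sum q K \<le> u}
        \<in> sets (\<Pi>\<^sub>M i\<in>K. lborel)"
      using K by measurable
    then have [measurable]: "(\<lambda>q. indicator {q. (\<forall>i\<in>K. 0 \<le> q i) \<and> sum q K \<le> u} q :: real)
        \<in> borel_measurable (\<Pi>\<^sub>M i\<in>K. lborel)"
      by (subst borel_measurable_indicator_iff) (auto simp: Int_def conj_commute)
    show ?thesis by measurable
  qed
  \<comment> \<open>Integrating out the coordinates in \<open>I\<close> with \<open>y\<close> fixed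
    turns the slack exponent \<open>b - 1\<close> into \<open>sum a I + b - 1\<close>. For
    \<open>y\<close> outside \<open>{0..s}\<close> no point of the simplex has that coordinate, so
    both sides are 0.\<close>
  have inner: "(\<integral>\<^sup>+x. ennreal (?f (insert j I) s (x(j := y))) \<partial>(\<Pi>\<^sub>M i\<in>I. lborel))
     = ennreal (?C * (y powr (a j - 1) * (s - y) powr (sum a I + b - 1) * indicator {0..s} y))" for y
  proof (cases "y \<in> {0..s}")
    case True
    have "(\<integral>\<^sup>+x. ennreal (?f (insert j I) s (x(j := y))) \<partial>(\<Pi>\<^sub>M i\<in>I. lborel))
        = (\<integral>\<^sup>+x. ennreal (y powr (a j - 1)) * ennreal (?f I (s - y) x) \<partial>(\<Pi>\<^sub>M i\<in>I. lborel))"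
    proof (intro nn_integral_cong)
      fix x :: "'i \<Rightarrow> real"
      have p: "(\<Prod>i\<in>I. (x(j := y)) i powr (a i - 1)) = (\<Prod>i\<in>I. x i powr (a i - 1))"
        using insert.hyps by (intro prod.cong) auto
      have q: "sum (x(j := y)) I = sum x I" using insert.hyps by (intro sum.cong) auto
      have r: "indicator {q. (\<forall>i\<in>insert j I. 0 \<le> q i) \<and> sum q (insert j I) \<le> s} (x(j := y))
          = (indicator {q. (\<forall>i\<in>I. 0 \<le> q i) \<and> sum q I \<le> s - y} x :: real)"
      proof -
        have "(\<forall>i\<in>insert j I. 0 \<le> (x(j := y)) i) \<longleftrightarrow> (\<forall>i\<in>I. 0 \<le> x i)"
          using True insert.hyps by (auto split: if_splits)
        moreover have "sum (x(j := y)) (insert j I) = y + sum x I" using insert.hyps q by simp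
        ultimately show ?thesis unfolding indicator_def mem_Collect_eq by (simp add: algebra_simps)
      qed
      show "ennreal (?f (insert j I) s (x(j := y))) = ennreal (y powr (a j - 1)) * ennreal (?f I (s - y) x)"
        unfolding r using insert.hyps p q
        by (simp add: ennreal_mult'[symmetric] mult_ac diff_diff_eq)
    qed
    also have "\<dots> = ennreal (y powr (a j - 1)) * (\<integral>\<^sup>+x. ennreal (?f I (s - y) x) \<partial>(\<Pi>\<^sub>M i\<in>I. lborel))"
      using insert.hyps by (intro nn_integral_cmult meas)
    also have "(\<integral>\<^sup>+x. ennreal (?f I (s - y) x) \<partial>(\<Pi>\<^sub>M i\<in>I. lborel))
       = ennreal ((s - y) powr (sum a I + b - 1) * ?C)"
      using True insert.prems by (intro insert.IH) auto
    also have "ennreal (y powr (a j - 1)) * \<dots>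
        = ennreal (?C * (y powr (a j - 1) * (s - y) powr (sum a I + b - 1) * indicator {0..s} y))"
      using True by (simp add: ennreal_mult'[symmetric] mult_ac)
    finally show ?thesis .
  next
    case False
    have "?f (insert j I) s (x(j := y)) = 0" for x
    proof -
      have "x(j := y) \<notin> {q. (\<forall>i\<in>insert j I. 0 \<le> q i) \<and> sum q (insert j I) \<le> s}"
      proof
        assume "x(j := y) \<in> {q. (\<forall>i\<in>insert j I. 0 \<le> q i) \<and> sum q (insert j I) \<le> s}"
        then have nn: "\<forall>i\<in>insert j I. 0 \<le> (x(j := y)) i" and le: "sum (x(j := y)) (insert j I) \<le> s"
          by blast+
        have "sum (x(j := y)) I \<ge> 0" using nn by (intro sum_nonneg) blast
        moreover have "y \<ge> 0" using nn by simp
        moreover have "sum (x(j := y)) (insert j I) = y + sum (x(j := y)) I"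
          by (subst sum.insert) (use insert.hyps in auto)
        ultimately show False using le False unfolding atLeastAtMost_iff by linarith
      qed
      then show ?thesis by (subst indicator_simps(2)) simp_all
    qed
    then have "(\<integral>\<^sup>+x. ennreal (?f (insert j I) s (x(j := y))) \<partial>(\<Pi>\<^sub>M i\<in>I. lborel)) = 0"
      by (simp only: ennreal_0 nn_integral_0_iff_AE nn_integral_const mult_zero_left)
    also have "0 = ennreal (?C * (y powr (a j - 1) * (s - y) powr (sum a I + b - 1) * indicator {0..s} y))"
      using False by simp
    finally show ?thesis .
  qed
  have "(\<integral>\<^sup>+q. ennreal (?f (insert j I) s q) \<partial>(\<Pi>\<^sub>M i\<in>insert j I. lborel))
      = (\<integral>\<^sup>+y. (\<integral>\<^sup>+x. ennreal (?f (insert j I) s (x(j := y))) \<partial>(\<Pi>\<^sub>M i\<in>I. lborel)) \<partial>lborel)"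
    using insert.hyps by (intro product_nn_integral_insert_rev meas) auto
  also have "\<dots> = (\<integral>\<^sup>+y. ennreal (?C * (y powr (a j - 1) * (s - y) powr (sum a I + b - 1) * indicator {0..s} y)) \<partial>lborel)"
    by (simp only: inner)
  also have "\<dots> = (\<integral>\<^sup>+y. ennreal ?C * ennreal (y powr (a j - 1) * (s - y) powr (sum a I + b - 1) * indicator {0..s} y) \<partial>lborel)"
    using C0 by (simp only: ennreal_mult')
  also have "\<dots> = ennreal ?C * ennreal (s powr (a j + (sum a I + b) - 1) * Beta (a j) (sum a I + b))"
    using nn_integral_Beta_scaled[OF aj sa insert.prems(3)] by (subst nn_integral_cmult) auto
  also have "\<dots> = ennreal (s powr (sum a (insert j I) + b - 1) *
      ((\<Prod>i\<in>insert j I. Gamma (a i)) * Gamma b / Gamma (sum a (insert j I) + b)))"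
  proof -
    have "Gamma (sum a I + b) \<noteq> 0" using Gamma_real_pos[OF sa] by simp
    then have eq: "?C * Beta (a j) (sum a I + b)
        = (\<Prod>i\<in>insert j I. Gamma (a i)) * Gamma b / Gamma (sum a (insert j I) + b)"
      using insert.hyps by (simp add: Beta_def field_simps add_ac)
    have "ennreal ?C * ennreal (s powr (a j + (sum a I + b) - 1) * Beta (a j) (sum a I + b))
        = ennreal (s powr (a j + (sum a I + b) - 1) * (?C * Beta (a j) (sum a I + b)))"
      using C0 by (subst ennreal_mult'[symmetric]) (simp_all add: mult_ac)
    moreover have "a j + (sum a I + b) = sum a (insert j I) + b" using insert.hyps by (simp add: add_ac)
    ultimately show ?thesis by (simp only: eq)
  qed
  finally show ?case .
qed

section \<open>The Dirichlet measure: total mass, support and inverse moments\<close>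

lemma borel_measurable_indicator_simplex_pts [measurable]:
  "(\<lambda>p. indicator (simplex_pts n) p :: real) \<in> borel_measurable (\<Pi>\<^sub>M i\<in>{1..n}. borel)"
proof -
  have "{p \<in> space (\<Pi>\<^sub>M i\<in>{1..n}. (borel :: real measure)). (\<Sum>i=1..n. p i) = 1 \<and> (\<forall>i\<in>{1..n}. p i \<ge> 0)}
      \<in> sets (\<Pi>\<^sub>M i\<in>{1..n}. borel)"
    by measurable
  also have "{p \<in> space (\<Pi>\<^sub>M i\<in>{1..n}. (borel :: real measure)). (\<Sum>i=1..n. p i) = 1 \<and> (\<forall>i\<in>{1..n}. p i \<ge> 0)}
      = simplex_pts n"
    by (auto simp: simplex_pts_def space_PiM PiE_def)
  finally show ?thesis by simp
qed

lemma borel_measurable_dirichlet_density [measurable]: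
  "dirichlet_density n a \<in> borel_measurable (\<Pi>\<^sub>M i\<in>{1..n}. borel)"
  unfolding dirichlet_density_def[abs_def] by measurable

text \<open>In the parametrization by the first \<open>n - 1\<close> coordinates, the last
  coordinate is exactly the slack of the solid simplex of size 1. This is therefore Dirichlet's
  integral with \<open>s = 1\<close> and \<open>b = a n\<close>.\<close>

lemma nn_integral_simplex_powr:
  assumes n: "n \<ge> 1" and a: "\<And>i. i \<in> {1..n} \<Longrightarrow> a i > 0"
  shows "(\<integral>\<^sup>+p. ennreal ((\<Prod>i=1..n. p i powr (a i - 1)) * indicator (simplex_pts n) p) \<partial>hyperplane_lebesgue n)
     = ennreal ((\<Prod>i=1..n. Gamma (a i)) / Gamma (\<Sum>i=1..n. a i))"
proof -
  let ?T = "\<lambda>q. \<lambda>i\<in>{1..n}. if i < n then q i else 1 - (\<Sum>j=1..<n. q j) :: real"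
  have T: "?T \<in> (\<Pi>\<^sub>M i\<in>{1..<n}. lborel) \<rightarrow>\<^sub>M (\<Pi>\<^sub>M i\<in>{1..n}. borel)"
  proof (rule measurable_restrict)
    fix i assume "i \<in> {1..n}"
    then show "(\<lambda>q. if i < n then q i else 1 - (\<Sum>j=1..<n. q j)) \<in> borel_measurable (\<Pi>\<^sub>M i\<in>{1..<n}. lborel)"
      by (cases "i < n") simp_all
  qed
  have set_eq: "{1..n} = insert n {1..<n}" using n by auto
  have "(\<integral>\<^sup>+p. ennreal ((\<Prod>i=1..n. p i powr (a i - 1)) * indicator (simplex_pts n) p) \<partial>hyperplane_lebesgue n)
    = (\<integral>\<^sup>+q. ennreal ((\<Prod>i=1..n. ?T q i powr (a i - 1)) * indicator (simplex_pts n) (?T q)) \<partial>(\<Pi>\<^sub>M i\<in>{1..<n}. lborel))"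
    unfolding hyperplane_lebesgue_def by (rule nn_integral_distr[OF T]) measurable
  also have "\<dots> = (\<integral>\<^sup>+q. ennreal ((\<Prod>i\<in>{1..<n}. q i powr (a i - 1)) * (1 - sum q {1..<n}) powr (a n - 1) *
             indicator {q. (\<forall>i\<in>{1..<n}. 0 \<le> q i) \<and> sum q {1..<n} \<le> 1} q) \<partial>(\<Pi>\<^sub>M i\<in>{1..<n}. lborel))"
  proof (intro nn_integral_cong arg_cong[where f = ennreal])
    fix q :: "nat \<Rightarrow> real"
    have p: "(\<Prod>i=1..n. ?T q i powr (a i - 1))
      = (\<Prod>i\<in>{1..<n}. q i powr (a i - 1)) * (1 - sum q {1..<n}) powr (a n - 1)"
      unfolding set_eq by (subst prod.insert) (auto intro!: prod.cong)
    have s: "(\<Sum>i=1..n. ?T q i) = 1"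
      unfolding set_eq by (subst sum.insert) (auto intro!: sum.cong simp: algebra_simps)
    have "(\<forall>i\<in>{1..n}. ?T q i \<ge> 0) \<longleftrightarrow> (\<forall>i\<in>{1..<n}. 0 \<le> q i) \<and> sum q {1..<n} \<le> 1"
      unfolding set_eq by auto
    with s have "indicator (simplex_pts n) (?T q)
      = (indicator {q. (\<forall>i\<in>{1..<n}. 0 \<le> q i) \<and> sum q {1..<n} \<le> 1} q :: real)"
      unfolding indicator_def simplex_pts_def by auto
    with p show "(\<Prod>i=1..n. ?T q i powr (a i - 1)) * indicator (simplex_pts n) (?T q)
      = (\<Prod>i\<in>{1..<n}. q i powr (a i - 1)) * (1 - sum q {1..<n}) powr (a n - 1) *
             indicator {q. (\<forall>i\<in>{1..<n}. 0 \<le> q i) \<and> sum q {1..<n} \<le> 1} q" by simp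
  qed
  also have "\<dots> = ennreal ((\<Prod>i\<in>{1..<n}. Gamma (a i)) * Gamma (a n) / Gamma (sum a {1..<n} + a n))"
    using n a by (subst nn_integral_Dirichlet) auto
  also have "\<dots> = ennreal ((\<Prod>i=1..n. Gamma (a i)) / Gamma (\<Sum>i=1..n. a i))"
    unfolding set_eq by (simp add: mult.commute add.commute)
  finally show ?thesis .
qed

lemma sets_dirichlet [measurable_cong]: "sets (dirichlet n a) = sets (\<Pi>\<^sub>M i\<in>{1..n}. borel)"
  by (simp add: dirichlet_def hyperplane_lebesgue_def)

lemma sets_hyperplane_lebesgue [measurable_cong]:
  "sets (hyperplane_lebesgue n) = sets (\<Pi>\<^sub>M i\<in>{1..n}. borel)"
  by (simp add: hyperplane_lebesgue_def)

lemma nn_integral_dirichlet: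
  assumes [measurable]: "g \<in> borel_measurable (\<Pi>\<^sub>M i\<in>{1..n}. borel)"
  shows "(\<integral>\<^sup>+p. g p \<partial>dirichlet n a) = (\<integral>\<^sup>+p. ennreal (dirichlet_density n a p * indicator (simplex_pts n) p) * g p \<partial>hyperplane_lebesgue n)"
  unfolding dirichlet_def by (rule nn_integral_density) measurable

lemma nn_integral_simplex_powr_cmult:
  assumes n: "n \<ge> 1" and a: "\<And>i. i \<in> {1..n} \<Longrightarrow> a i > 0" and C: "C \<ge> 0"
  shows "(\<integral>\<^sup>+p. ennreal C * ennreal ((\<Prod>i=1..n. p i powr (a i - 1)) * indicator (simplex_pts n) p) \<partial>hyperplane_lebesgue n)
     = ennreal (C * ((\<Prod>i=1..n. Gamma (a i)) / Gamma (\<Sum>i=1..n. a i)))"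
proof -
  have "(\<lambda>p. ennreal ((\<Prod>i=1..n. p i powr (a i - 1)) * indicator (simplex_pts n) p)) \<in> borel_measurable (hyperplane_lebesgue n)"
    by measurable
  then show ?thesis
    by (simp only: nn_integral_cmult nn_integral_simplex_powr[OF n a] ennreal_mult'[OF C])
qed

lemma prob_space_dirichlet:
  assumes n: "n \<ge> 1" and a: "\<And>i. i \<in> {1..n} \<Longrightarrow> a i > 0"
  shows "prob_space (dirichlet n a)"
proof
  let ?B = "(\<Prod>i=1..n. Gamma (a i)) / Gamma (\<Sum>i=1..n. a i)"
  have sa: "(\<Sum>i=1..n. a i) > 0" using n a by (intro sum_pos) auto
  have B: "?B > 0" using a sa by (intro divide_pos_pos prod_pos) (auto intro: Gamma_real_pos)
  have "emeasure (dirichlet n a) (space (dirichlet n a)) = (\<integral>\<^sup>+p. 1 \<partial>dirichlet n a)" by simp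
  also have "\<dots> = (\<integral>\<^sup>+p. ennreal (1 / ?B) * ennreal ((\<Prod>i=1..n. p i powr (a i - 1)) * indicator (simplex_pts n) p) \<partial>hyperplane_lebesgue n)"
  proof (subst nn_integral_dirichlet)
    show "(\<integral>\<^sup>+p. ennreal (dirichlet_density n a p * indicator (simplex_pts n) p) * 1 \<partial>hyperplane_lebesgue n) =
      (\<integral>\<^sup>+p. ennreal (1 / ?B) * ennreal ((\<Prod>i=1..n. p i powr (a i - 1)) * indicator (simplex_pts n) p) \<partial>hyperplane_lebesgue n)"
    proof (intro nn_integral_cong, subst ennreal_mult'[symmetric])
      show "0 \<le> 1 / ?B" by (rule divide_nonneg_pos[OF zero_le_one B])
    qed (simp add: dirichlet_density_def mult_ac)
  qed simp
  also have "\<dots> = ennreal (1 / ?B * ?B)"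
    by (rule nn_integral_simplex_powr_cmult[OF n a divide_nonneg_pos[OF zero_le_one B]])
  also have "1 / ?B * ?B = 1"
  proof -
    have "1 / x * x = 1" if "x > 0" for x :: real using that by simp
    from this[OF B] show ?thesis .
  qed
  finally show "emeasure (dirichlet n a) (space (dirichlet n a)) = 1" by simp
qed

text \<open>Since \<open>0 powr _ = 0\<close>, the density vanishes at every point having a zero
  coordinate. Almost surely, then, \<open>elog\<close> is finite and the likelihood region can be
  handled with real logarithms.\<close>

lemma AE_dirichlet_pos:
  "AE p in dirichlet n a. p \<in> simplex_pts n \<and> (\<forall>i\<in>{1..n}. p i > 0)"
  unfolding dirichlet_def
proof (subst AE_density)
  show "AE p in hyperplane_lebesgue n. 0 < ennreal (dirichlet_density n a p * indicator (simplex_pts n) p)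
      \<longrightarrow> p \<in> simplex_pts n \<and> (\<forall>i\<in>{1..n}. p i > 0)"
  proof (intro AE_I2 impI)
    fix p assume "0 < ennreal (dirichlet_density n a p * indicator (simplex_pts n) p)"
    then have "dirichlet_density n a p * indicator (simplex_pts n) p \<noteq> 0" by auto
    then have nz: "dirichlet_density n a p \<noteq> 0" and s: "p \<in> simplex_pts n"
      by (auto simp: indicator_def split: if_splits)
    from nz have "\<forall>i\<in>{1..n}. p i \<noteq> 0" by (auto simp: dirichlet_density_def)
    with s show "p \<in> simplex_pts n \<and> (\<forall>i\<in>{1..n}. p i > 0)"
      unfolding simplex_pts_def mem_Collect_eq by (auto simp: less_le)
  qed
qed measurable

text \<open>Dividing the density by \<open>p j\<close> lowers the parameter \<open>a j\<close> by
  one, so the integral is again a Dirichlet integral, convergent because \<open>a j > 1\<close>. The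
  quotient of the two normalizing constants collapses by \<open>Gamma (x + 1) = x * Gamma x\<close>,
  applied to \<open>a j\<close> and to the total.\<close>

lemma expectation_dirichlet_inverse:
  assumes a: "\<And>i. i \<in> {1..n} \<Longrightarrow> a i > 0" and j: "j \<in> {1..n}" "a j > 1"
  shows "integrable (dirichlet n a) (\<lambda>p. 1 / p j)"
    and "(\<integral>p. 1 / p j \<partial>dirichlet n a) = ((\<Sum>i=1..n. a i) - 1) / (a j - 1)"
proof -
  let ?b = "a(j := a j - 1)"
  let ?C = "Gamma (\<Sum>i=1..n. a i) / (\<Prod>i=1..n. Gamma (a i))"
  let ?B = "(\<Prod>i=1..n. Gamma (?b i)) / Gamma (\<Sum>i=1..n. ?b i)"
  have n: "n \<ge> 1" using j by simp
  note remove = sum.remove[OF finite_atLeastAtMost j(1)] prod.remove[OF finite_atLeastAtMost j(1)]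
  have sb: "(\<Sum>i=1..n. ?b i) = (\<Sum>i=1..n. a i) - 1"
    unfolding remove by simp
  have b: "\<And>i. i \<in> {1..n} \<Longrightarrow> ?b i > 0" using a j by auto
  have sbp: "(\<Sum>i=1..n. ?b i) > 0" using n b by (intro sum_pos) auto
  have C: "?C \<ge> 0" using a sbp sb j
    by (intro divide_nonneg_nonneg prod_nonneg) (auto intro!: less_imp_le Gamma_real_pos)
  have pj_meas [measurable]: "(\<lambda>p. p j) \<in> borel_measurable (\<Pi>\<^sub>M i\<in>{1..n}. (borel :: real measure))"
    using j(1) by (rule measurable_component_singleton)
  have "(\<integral>\<^sup>+p. ennreal (1 / p j) \<partial>dirichlet n a)
      = (\<integral>\<^sup>+p. ennreal ?C * ennreal ((\<Prod>i=1..n. p i powr (?b i - 1)) * indicator (simplex_pts n) p) \<partial>hyperplane_lebesgue n)"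
  proof (subst nn_integral_dirichlet)
    show "(\<integral>\<^sup>+p. ennreal (dirichlet_density n a p * indicator (simplex_pts n) p) * ennreal (1 / p j) \<partial>hyperplane_lebesgue n)
      = (\<integral>\<^sup>+p. ennreal ?C * ennreal ((\<Prod>i=1..n. p i powr (?b i - 1)) * indicator (simplex_pts n) p) \<partial>hyperplane_lebesgue n)"
    proof (intro nn_integral_cong)
      fix p
      show "ennreal (dirichlet_density n a p * indicator (simplex_pts n) p) * ennreal (1 / p j)
        = ennreal ?C * ennreal ((\<Prod>i=1..n. p i powr (?b i - 1)) * indicator (simplex_pts n) p)"
      proof (cases "p \<in> simplex_pts n")
        case True
        then have pj: "p j \<ge> 0" using j by (auto simp: simplex_pts_def)
        \<comment> \<open>This includes \<open>p j = 0\<close>, where both sides are 0.\<close>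
        have "p j powr (a j - 1 - 1) = p j powr (a j - 1) / p j"
          using pj by (subst powr_diff) simp
        then have "(\<Prod>i=1..n. p i powr (?b i - 1)) = (\<Prod>i=1..n. p i powr (a i - 1)) / p j"
          unfolding remove by simp
        then show ?thesis using True C pj
          by (simp add: dirichlet_density_def ennreal_mult'[symmetric] ennreal_mult''[symmetric])
      qed simp
    qed
    show "(\<lambda>p. ennreal (1 / p j)) \<in> borel_measurable (\<Pi>\<^sub>M i\<in>{1..n}. borel)"
      using pj_meas by simp
  qed
  also have "\<dots> = ennreal (?C * ?B)"
    by (rule nn_integral_simplex_powr_cmult[OF n b C])
  also have "?C * ?B = ((\<Sum>i=1..n. a i) - 1) / (a j - 1)"
  proof -
    let ?P = "\<Prod>i\<in>{1..n} - {j}. Gamma (a i)"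
    have P: "?P > 0" using a by (intro prod_pos Gamma_real_pos) auto
    have 1: "Gamma (a j) = (a j - 1) * Gamma (a j - 1)"
      using Gamma_plus1[of "a j - 1"] j by (force dest: nonpos_Ints_nonpos)
    have 2: "Gamma (\<Sum>i=1..n. a i) = ((\<Sum>i=1..n. a i) - 1) * Gamma ((\<Sum>i=1..n. a i) - 1)"
      using Gamma_plus1[of "(\<Sum>i=1..n. a i) - 1"] sbp sb by (force dest: nonpos_Ints_nonpos)
    have 3: "(\<Prod>i=1..n. Gamma (a i)) = Gamma (a j) * ?P"
      unfolding remove by simp
    have 4: "(\<Prod>i=1..n. Gamma (?b i)) = Gamma (a j - 1) * ?P"
      unfolding remove by simp
    have "Gamma (a j - 1) > 0" "Gamma ((\<Sum>i=1..n. a i) - 1) > 0"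
      using j sbp sb by (auto intro!: Gamma_real_pos)
    moreover have "(y * h) / ((x * g) * P) * ((g * P) / h) = y / x"
      if "g > 0" "h > 0" "P > 0" "x > 0" for g h P x y :: real
      using that by (simp add: divide_simps)
    ultimately show ?thesis unfolding sb 1 2 3 4 using P j by (metis diff_gt_0_iff_gt)
  qed
  finally have "(\<integral>\<^sup>+p. ennreal (1 / p j) \<partial>dirichlet n a) = ennreal (((\<Sum>i=1..n. a i) - 1) / (a j - 1))" .
  moreover have "AE p in dirichlet n a. 0 \<le> 1 / p j"
    using AE_dirichlet_pos[of n a] by eventually_elim (use j in \<open>auto intro: less_imp_le\<close>)
  ultimately have "integrable (dirichlet n a) (\<lambda>p. 1 / p j) \<and>
      (\<integral>p. 1 / p j \<partial>dirichlet n a) = ((\<Sum>i=1..n. a i) - 1) / (a j - 1)"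
    using j sbp sb by (subst nn_integral_eq_integrable[symmetric]) auto
  then show "integrable (dirichlet n a) (\<lambda>p. 1 / p j)"
    and "(\<integral>p. 1 / p j \<partial>dirichlet n a) = ((\<Sum>i=1..n. a i) - 1) / (a j - 1)" by auto
qed

section \<open>Likelihood regions and the two-sided bound on the threshold\<close>

lemma sets_likelihood_region: "likelihood_region n c \<gamma> \<in> sets (\<Pi>\<^sub>M i\<in>{1..n}. borel)"
proof -
  have [measurable]: "elog \<in> borel_measurable borel" unfolding elog_def[abs_def] by measurable
  have "simplex_pts n \<in> sets (\<Pi>\<^sub>M i\<in>{1..n}. borel)"
    using borel_measurable_indicator_simplex_pts[of n]
    by (subst (asm) borel_measurable_indicator_iff) (auto simp: simplex_pts_def space_PiM PiE_def Int_absorb2 Int_absorb1)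
  moreover have "{p \<in> space (\<Pi>\<^sub>M i\<in>{1..n}. (borel :: real measure)). (\<Sum>i=1..n. ereal (real (c i)) * elog (p i)) \<ge> ereal \<gamma>}
      \<in> sets (\<Pi>\<^sub>M i\<in>{1..n}. borel)"
    by measurable
  ultimately have "simplex_pts n \<inter> {p \<in> space (\<Pi>\<^sub>M i\<in>{1..n}. (borel :: real measure)).
      (\<Sum>i=1..n. ereal (real (c i)) * elog (p i)) \<ge> ereal \<gamma>} \<in> sets (\<Pi>\<^sub>M i\<in>{1..n}. borel)"
    by (rule sets.Int)
  also have "simplex_pts n \<inter> {p \<in> space (\<Pi>\<^sub>M i\<in>{1..n}. (borel :: real measure)).
      (\<Sum>i=1..n. ereal (real (c i)) * elog (p i)) \<ge> ereal \<gamma>} = likelihood_region n c \<gamma>"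
    by (auto simp: likelihood_region_def simplex_pts_def space_PiM PiE_def)
  finally show ?thesis .
qed

lemma likelihood_region_pos_iff:
  assumes "p \<in> simplex_pts n" "\<forall>i\<in>{1..n}. p i > 0"
  shows "p \<in> likelihood_region n c \<gamma> \<longleftrightarrow> (\<Sum>i=1..n. real (c i) * ln (p i)) \<ge> \<gamma>"
proof -
  have "(\<Sum>i=1..n. ereal (real (c i)) * elog (p i)) = (\<Sum>i=1..n. ereal (real (c i) * ln (p i)))"
    using assms by (intro sum.cong) (auto simp: elog_def)
  then show ?thesis using assms by (simp add: likelihood_region_def)
qed

text \<open>Above the maximal log-likelihood the region is a null set, which excludes mass
  \<open>1 - \<alpha>\<close>. If \<open>\<gamma>\<close> were more than \<open>t\<close> below the
  maximum, the complement of the region, of mass \<open>\<alpha>\<close>, would push the mean of a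
  nonnegative majorant of the log-likelihood deficit up to \<open>\<alpha> * t\<close>, while that
  mean is at most \<open>2 * n\<close>. Counts of at least 2 make the inverse moments finite. The
  deviation \<open>t\<close> stays free so that it can later grow like
  \<open>sqrt N\<close>.\<close>

lemma likelihood_threshold_bounds:
  fixes c :: "nat \<Rightarrow> nat"
  assumes n: "n \<ge> 1" and c: "\<And>i. i \<in> {1..n} \<Longrightarrow> c i \<ge> 2" and N: "(\<Sum>i=1..n. c i) = N"
    and \<alpha>: "\<alpha> > 0" "\<alpha> < 1"
    and meas: "measure (dirichlet n (\<lambda>i. real (c i))) (likelihood_region n c \<gamma>) = 1 - \<alpha>"
    and t: "2 * real n < \<alpha> * t"
  shows "(\<Sum>i=1..n. real (c i) * ln (real (c i) / real N)) - t \<le> \<gamma>"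
    and "\<gamma> \<le> (\<Sum>i=1..n. real (c i) * ln (real (c i) / real N))"
proof -
  let ?D = "dirichlet n (\<lambda>i. real (c i))" and ?R = "likelihood_region n c \<gamma>"
  let ?H = "\<Sum>i=1..n. real (c i) * ln (real (c i) / real N)"
  let ?W = "\<lambda>p. \<Sum>i=1..n. (real (c i))\<^sup>2 / real N * (1 / p i)"
  have cpos: "\<And>i. i \<in> {1..n} \<Longrightarrow> real (c i) > 0" using c by force
  interpret D: prob_space ?D using n cpos by (intro prob_space_dirichlet)
  have RN: "(\<Sum>i=1..n. real (c i)) = real N" using N by (simp flip: of_nat_sum)
  have Npos: "real N > 0" unfolding RN[symmetric] using n cpos by (intro sum_pos) auto
  have R [measurable]: "?R \<in> sets ?D" using sets_likelihood_region by (simp add: sets_dirichlet)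
  have diff: "?H - (\<Sum>i=1..n. real (c i) * ln (p i)) = (\<Sum>i=1..n. real (c i) * ln (real (c i) / (real N * p i)))"
    if "\<forall>i\<in>{1..n}. p i > 0" for p
    unfolding sum_subtractf[symmetric]
  proof (intro sum.cong refl)
    fix i assume "i \<in> {1..n}"
    with that cpos have "p i > 0" "real (c i) > 0" by auto
    then show "real (c i) * ln (real (c i) / real N) - real (c i) * ln (p i) = real (c i) * ln (real (c i) / (real N * p i))"
      using Npos by (simp add: ln_div ln_mult algebra_simps)
  qed
  have gibbs: "(\<Sum>i=1..n. real (c i) * ln (p i)) \<le> ?H" if p: "p \<in> simplex_pts n" "\<forall>i\<in>{1..n}. p i > 0" for p
  proof -
    have "(\<Sum>i=1..n. real (c i) * ln (real (c i) / (real N * p i)))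
        \<ge> (\<Sum>i=1..n. real (c i) - real N * p i)"
    proof (rule sum_mono)
      fix i assume i: "i \<in> {1..n}"
      have "ln (real N * p i / real (c i)) \<le> real N * p i / real (c i) - 1"
        using p i cpos Npos by (intro ln_le_minus_one) auto
      then have "real (c i) * ln (real N * p i / real (c i)) \<le> real (c i) * (real N * p i / real (c i) - 1)"
        using cpos[OF i] by (intro mult_left_mono) auto
      moreover have "ln (real N * p i / real (c i)) = - ln (real (c i) / (real N * p i))"
        using p i cpos Npos by (simp add: ln_div)
      ultimately show "real (c i) - real N * p i \<le> real (c i) * ln (real (c i) / (real N * p i))"
        using cpos[OF i] by (simp add: algebra_simps)
    qed
    also have "(\<Sum>i=1..n. real (c i) - real N * p i) = 0"
      using p RN by (simp add: sum_subtractf sum_distrib_left[symmetric] simplex_pts_def)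
    finally show ?thesis using diff[OF p(2)] by linarith
  qed
  \<comment> \<open>The inequality used for \<open>gibbs\<close>, now applied to the reciprocal
    ratio \<open>c i / (N * p i)\<close>, gives a majorant that is affine in the
    \<open>1 / p i\<close>, whose means are known exactly.\<close>
  have upper: "?H - (\<Sum>i=1..n. real (c i) * ln (p i)) \<le> ?W p - real N"
    if p: "p \<in> simplex_pts n" "\<forall>i\<in>{1..n}. p i > 0" for p
  proof -
    have "(\<Sum>i=1..n. real (c i) * ln (real (c i) / (real N * p i)))
        \<le> (\<Sum>i=1..n. (real (c i))\<^sup>2 / real N * (1 / p i) - real (c i))"
    proof (rule sum_mono)
      fix i assume i: "i \<in> {1..n}"
      have "real (c i) * ln (real (c i) / (real N * p i)) \<le> real (c i) * (real (c i) / (real N * p i) - 1)"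
        using p i cpos Npos by (intro mult_left_mono ln_le_minus_one) auto
      then show "real (c i) * ln (real (c i) / (real N * p i)) \<le> (real (c i))\<^sup>2 / real N * (1 / p i) - real (c i)"
        by (simp add: algebra_simps power2_eq_square)
    qed
    then show ?thesis using diff[OF p(2)] RN by (simp add: sum_subtractf)
  qed
  show "\<gamma> \<le> ?H"
  proof (rule ccontr)
    assume "\<not> \<gamma> \<le> ?H"
    with gibbs have "p \<notin> ?R" if "p \<in> simplex_pts n" "\<forall>i\<in>{1..n}. p i > 0" for p
      using that likelihood_region_pos_iff[OF that] by (meson order_trans)
    then have "AE p in ?D. p \<notin> ?R"
      by (intro eventually_mono[OF AE_dirichlet_pos]) blast
    then have "measure ?D ?R = 0" by (subst D.prob_eq_0) auto
    with meas \<alpha> show False by simp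
  qed
  show "?H - t \<le> \<gamma>"
  proof (rule ccontr)
    assume *: "\<not> ?H - t \<le> \<gamma>"
    let ?Q = "space ?D - ?R"
    \<comment> \<open>Markov's inequality for \<open>?W - N\<close>, whose nonnegativity comes from \<open>gibbs\<close>.\<close>
    have W: "integrable ?D ?W"
      using c by (intro Bochner_Integration.integrable_sum integrable_mult_right expectation_dirichlet_inverse) force+
    have "(\<integral>p. real N + t * indicator ?Q p \<partial>?D) \<le> (\<integral>p. ?W p \<partial>?D)"
    proof (rule integral_mono_AE)
      show "AE p in ?D. real N + t * indicator ?Q p \<le> ?W p"
        using AE_dirichlet_pos[of n "\<lambda>i. real (c i)"]
      proof (eventually_elim)
        case (elim p)
        then have e: "p \<in> simplex_pts n" "\<forall>i\<in>{1..n}. p i > 0" by auto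
        show ?case using gibbs[OF e] upper[OF e] * likelihood_region_pos_iff[OF e, of c \<gamma>]
          by (auto simp: indicator_def)
      qed
      show "integrable ?D (\<lambda>p. real N + t * indicator ?Q p)"
        by (intro Bochner_Integration.integrable_add integrable_mult_right integrable_real_indicator D.integrable_const)
          (auto simp: D.emeasure_eq_measure)
    qed (rule W)
    also have "(\<integral>p. real N + t * indicator ?Q p \<partial>?D) = real N + t * D.prob ?Q"
      by (subst Bochner_Integration.integral_add) (auto simp: D.prob_space D.emeasure_eq_measure intro!: integrable_mult_right integrable_real_indicator)
    also have "D.prob ?Q = \<alpha>" using meas by (subst D.prob_compl) auto
    also have "(\<integral>p. ?W p \<partial>?D) = (\<Sum>i=1..n. (real (c i))\<^sup>2 / real N * ((real N - 1) / (real (c i) - 1)))"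
    proof (subst Bochner_Integration.integral_sum)
      show "integrable ?D (\<lambda>p. (real (c i))\<^sup>2 / real N * (1 / p i))" if "i \<in> {1..n}" for i
        using that c by (intro integrable_mult_right expectation_dirichlet_inverse) force+
      show "(\<Sum>i=1..n. \<integral>p. (real (c i))\<^sup>2 / real N * (1 / p i) \<partial>?D)
        = (\<Sum>i=1..n. (real (c i))\<^sup>2 / real N * ((real N - 1) / (real (c i) - 1)))"
      proof (intro sum.cong refl)
        fix i assume i: "i \<in> {1..n}"
        have "(\<integral>p. 1 / p i \<partial>?D) = (real N - 1) / (real (c i) - 1)"
          using expectation_dirichlet_inverse(2)[of n "\<lambda>i. real (c i)" i] cpos c[OF i] i RN by auto
        then show "(\<integral>p. (real (c i))\<^sup>2 / real N * (1 / p i) \<partial>?D)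
          = (real (c i))\<^sup>2 / real N * ((real N - 1) / (real (c i) - 1))"
          by (subst integral_mult_right_zero) simp
      qed
    qed
    \<comment> \<open>Each summand exceeds \<open>c i\<close> by at most 2; after clearing
      denominators this is where \<open>c i \<ge> 2\<close> enters. The sum is
      \<open>N + 2 * n\<close>, so \<open>\<alpha> * t \<le> 2 * n\<close>, contrary to the choice
      of \<open>t\<close>.\<close>
    also have "\<dots> \<le> (\<Sum>i=1..n. real (c i) + 2)"
    proof (rule sum_mono)
      fix i assume i: "i \<in> {1..n}"
      have c2: "real (c i) \<ge> 2" using c[OF i] by simp
      have "(real (c i))\<^sup>2 * (real N - 1) \<le> (real (c i) + 2) * (real N * (real (c i) - 1))"
      proof -
        have "(real (c i) + 2) * (real N * (real (c i) - 1)) - (real (c i))\<^sup>2 * (real N - 1)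
          = real N * (real (c i) - 2) + (real (c i))\<^sup>2"
          by (simp add: algebra_simps power2_eq_square)
        also have "\<dots> \<ge> 0" using c2 by simp
        finally show ?thesis by simp
      qed
      then show "(real (c i))\<^sup>2 / real N * ((real N - 1) / (real (c i) - 1)) \<le> real (c i) + 2"
        using c2 Npos by (simp add: pos_divide_le_eq)
    qed
    also have "\<dots> = real N + 2 * real n" using RN by (simp add: sum.distrib)
    finally show False using t by (simp add: mult.commute)
  qed
qed

section \<open>Characteristic functions\<close>

text \<open>With \<open>Y\<close> distributed as \<open>A z\<close>, the combination
  \<open>w . Y\<close> becomes \<open>c . z\<close> for \<open>c = A^T w\<close>. Independence of
  the \<open>z l\<close> factors the characteristic function, and the exponents add up to
  \<open>|A^T w|^2 = w^T S w\<close>. No inverse of \<open>S\<close> appears, so singular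
  covariances are covered.\<close>

lemma char_distr_multivariate_normal_linear:
  assumes "multivariate_normal M n Y (\<lambda>_. 0) S"
  shows "char (distr M borel (\<lambda>\<omega>. \<Sum>i=1..n. w i * Y i \<omega>)) t
    = exp (- (t\<^sup>2 * (\<Sum>i=1..n. \<Sum>j=1..n. w i * w j * S i j)) / 2)"
proof -
  from assms obtain k and A :: "nat \<Rightarrow> nat \<Rightarrow> real" where
    A: "\<And>i j. i \<in> {1..n} \<Longrightarrow> j \<in> {1..n} \<Longrightarrow> (\<Sum>l=1..k. A i l * A j l) = S i j" and
    Y: "\<And>i. i \<in> {1..n} \<Longrightarrow> Y i \<in> borel_measurable M" and
    D: "distr M (\<Pi>\<^sub>M i\<in>{1..n}. borel) (\<lambda>\<omega>. \<lambda>i\<in>{1..n}. Y i \<omega>) =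
        distr (\<Pi>\<^sub>M l\<in>{1..k}. std_normal_distribution) (\<Pi>\<^sub>M i\<in>{1..n}. borel)
          (\<lambda>z. \<lambda>i\<in>{1..n}. \<Sum>l=1..k. A i l * z l)"
    unfolding multivariate_normal_def add_0_left by blast
  define c where "c l = (\<Sum>i=1..n. w i * A i l)" for l
  interpret prob_space std_normal_distribution by (intro prob_space_normal_density) simp
  interpret product_sigma_finite "\<lambda>_::nat. std_normal_distribution" ..
  let ?P = "\<Pi>\<^sub>M l\<in>{1..k}. std_normal_distribution"
  let ?h = "\<lambda>y. \<Sum>i=1..n. w i * y i"
  have h: "?h \<in> borel_measurable (\<Pi>\<^sub>M i\<in>{1..n}. borel)" by measurable
  have lin: "(\<lambda>z. \<lambda>i\<in>{1..n}. \<Sum>l=1..k. A i l * z l) \<in> ?P \<rightarrow>\<^sub>M (\<Pi>\<^sub>M i\<in>{1..n}. borel)"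
    by (intro measurable_restrict borel_measurable_sum borel_measurable_times borel_measurable_const)
      (simp add: measurable_component_singleton[where M = "\<lambda>_. std_normal_distribution", simplified])
  have "distr M borel (\<lambda>\<omega>. \<Sum>i=1..n. w i * Y i \<omega>)
      = distr (distr M (\<Pi>\<^sub>M i\<in>{1..n}. borel) (\<lambda>\<omega>. \<lambda>i\<in>{1..n}. Y i \<omega>)) borel ?h"
    by (subst distr_distr[OF h]) (auto intro!: measurable_restrict Y distr_cong sum.cong simp: comp_def)
  also have "\<dots> = distr ?P borel (\<lambda>z. \<Sum>l=1..k. c l * z l)"
    unfolding D
  proof (subst distr_distr[OF h lin], rule distr_cong)
    fix z
    have "(\<Sum>i=1..n. w i * (\<Sum>l=1..k. A i l * z l)) = (\<Sum>l=1..k. c l * z l)"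
      unfolding c_def sum_distrib_left sum_distrib_right
      by (subst sum.swap) (simp add: mult_ac)
    then show "(?h \<circ> (\<lambda>z. \<lambda>i\<in>{1..n}. \<Sum>l=1..k. A i l * z l)) z = (\<Sum>l=1..k. c l * z l)"
      by simp
  qed simp_all
  finally have "char (distr M borel (\<lambda>\<omega>. \<Sum>i=1..n. w i * Y i \<omega>)) t
      = (\<integral>z. iexp (t * (\<Sum>l=1..k. c l * z l)) \<partial>?P)"
    unfolding char_def
    by (simp, subst integral_distr) (auto intro!: borel_measurable_sum borel_measurable_times
      simp: measurable_component_singleton[where M = "\<lambda>_. std_normal_distribution", simplified])
  also have "\<dots> = (\<integral>z. (\<Prod>l=1..k. iexp (t * c l * z l)) \<partial>?P)"
    by (simp add: sum_distrib_left exp_sum mult_ac)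
  also have "\<dots> = (\<Prod>l=1..k. \<integral>x. iexp (t * c l * x) \<partial>std_normal_distribution)"
    by (intro product_integral_prod) (auto intro!: integrable_const_bound[where B = 1])
  also have "\<dots> = (\<Prod>l=1..k. exp (- ((t * c l)\<^sup>2) / 2))"
  proof -
    have "(\<integral>x. iexp (t * c l * x) \<partial>std_normal_distribution) = exp (- ((t * c l)\<^sup>2) / 2)" for l
      using fun_cong[OF char_std_normal_distribution, of "t * c l"] unfolding char_def .
    then show ?thesis by (simp only: of_real_prod)
  qed
  also have "\<dots> = exp (- (t\<^sup>2 * (\<Sum>l=1..k. (c l)\<^sup>2)) / 2)"
    by (simp add: exp_sum[symmetric] power_mult_distrib sum_distrib_left sum_divide_distrib sum_negf)
  also have "(\<Sum>l=1..k. (c l)\<^sup>2) = (\<Sum>i=1..n. \<Sum>j=1..n. w i * w j * S i j)"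
  proof -
    have "(\<Sum>l=1..k. (c l)\<^sup>2) = (\<Sum>l=1..k. \<Sum>i=1..n. \<Sum>j=1..n. w i * w j * (A i l * A j l))"
      unfolding c_def power2_eq_square sum_product by (simp add: mult_ac)
    also have "\<dots> = (\<Sum>i=1..n. \<Sum>l=1..k. \<Sum>j=1..n. w i * w j * (A i l * A j l))"
      by (rule sum.swap)
    also have "\<dots> = (\<Sum>i=1..n. \<Sum>j=1..n. \<Sum>l=1..k. w i * w j * (A i l * A j l))"
      by (rule sum.cong[OF refl sum.swap])
    also have "\<dots> = (\<Sum>i=1..n. \<Sum>j=1..n. w i * w j * S i j)"
      by (intro sum.cong refl) (simp only: A sum_distrib_left[symmetric])
    finally show ?thesis .
  qed
  finally show ?thesis by simp
qed

text \<open>A central limit theorem for rows living on different probability spaces. At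
  \<open>t / sqrt N\<close> each factor is \<open>1 - t^2 v / (2 N)\<close> up to an error of order
  \<open>N^(-3/2)\<close>, controlled by the third absolute moment and hence by \<open>B^3\<close>.
  A product of factors of norm at most 1 changes by no more than the sum of the individual errors,
  here of order \<open>1 / sqrt N\<close>, and the \<open>N\<close>-th power of the approximant
  tends to the exponential.\<close>

lemma char_bounded_array_tendsto:
  fixes M :: "nat \<Rightarrow> 'a measure" and Z :: "nat \<Rightarrow> nat \<Rightarrow> 'a \<Rightarrow> real"
  assumes prob: "\<And>N. prob_space (M N)"
    and indep: "\<And>N. prob_space.indep_vars (M N) (\<lambda>_. borel) (Z N) {1..N}"
    and bound: "\<And>N k \<omega>. k \<in> {1..N} \<Longrightarrow> \<omega> \<in> space (M N) \<Longrightarrow> \<bar>Z N k \<omega>\<bar> \<le> B"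
    and mean: "\<And>N k. k \<in> {1..N} \<Longrightarrow> (\<integral>\<omega>. Z N k \<omega> \<partial>M N) = 0"
    and var: "\<And>N k. k \<in> {1..N} \<Longrightarrow> (\<integral>\<omega>. (Z N k \<omega>)\<^sup>2 \<partial>M N) = v"
  shows "(\<lambda>N. char (distr (M N) borel (\<lambda>\<omega>. (\<Sum>k=1..N. Z N k \<omega>) / sqrt (real N))) t)
     \<longlonglongrightarrow> exp (- (t\<^sup>2 * v) / 2)"
proof -
  define \<phi> where "\<phi> N = char (distr (M N) borel (\<lambda>\<omega>. (\<Sum>k=1..N. Z N k \<omega>) / sqrt (real N))) t" for N
  \<comment> \<open>The single entry of row 1 exhibits \<open>v\<close> as a second moment; a point
    of its sample space then gives \<open>B \<ge> 0\<close>.\<close>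
  have v: "v \<ge> 0" unfolding var[of 1 1, simplified, symmetric] by simp
  obtain \<omega>0 where "\<omega>0 \<in> space (M 1)" using prob_space.not_empty[OF prob] by blast
  then have B: "B \<ge> 0" using bound[of 1 1 \<omega>0] by simp
  let ?a = "\<lambda>N::nat. 1 + (- (t\<^sup>2 * v) / 2) / real N"
  have main: "norm (\<phi> N - of_real (?a N ^ N)) \<le> (\<bar>t\<bar> ^ 3 * B ^ 3 / 6) / sqrt (real N)"
    if N: "N \<ge> 1" "real N \<ge> t\<^sup>2 * v / 4" for N
  proof -
    interpret prob_space "M N" by (rule prob)
    let ?s = "t / sqrt (real N)"
    have Npos: "real N > 0" using N by simp
    have rv: "Z N k \<in> borel_measurable (M N)" if "k \<in> {1..N}" for k
      using indep[of N] that unfolding indep_vars_def2 by blast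
    have "\<phi> N = char (distr (M N) borel (\<lambda>\<omega>. \<Sum>k=1..N. Z N k \<omega> / sqrt (real N))) t"
      by (simp add: \<phi>_def sum_divide_distrib)
    also have "\<dots> = (\<Prod>k=1..N. char (distr (M N) borel (\<lambda>\<omega>. Z N k \<omega> / sqrt (real N))) t)"
      by (rule char_distr_sum) (rule indep_vars_compose2[OF indep, where Y = "\<lambda>_ x. x / sqrt (real N)"], simp)
    also have "\<dots> = (\<Prod>k=1..N. char (distr (M N) borel (Z N k)) ?s)"
      by (intro prod.cong refl) (use rv in \<open>simp add: char_def integral_distr\<close>)
    finally have \<phi>: "\<phi> N = (\<Prod>k=1..N. char (distr (M N) borel (Z N k)) ?s)" .
    have each: "norm (char (distr (M N) borel (Z N k)) ?s - of_real (?a N)) \<le> \<bar>?s\<bar> ^ 3 * B ^ 3 / 6"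
      if k: "k \<in> {1..N}" for k
    proof -
      note rv[OF k, measurable]
      have b: "AE \<omega> in M N. norm (Z N k \<omega>) \<le> B" using bound[OF k] by auto
      have i1: "integrable (M N) (Z N k)" by (rule integrable_const_bound[OF b]) simp
      have i2: "integrable (M N) (\<lambda>\<omega>. (Z N k \<omega>)\<^sup>2)"
        by (rule integrable_const_bound[where B = "B\<^sup>2"]) (use bound[OF k] in \<open>auto intro!: AE_I2 simp: abs_le_square_iff[symmetric] B\<close>)
      have "norm (char (distr (M N) borel (Z N k)) ?s - (1 - ?s\<^sup>2 * v / 2)) \<le>
          ?s\<^sup>2 / 6 * expectation (\<lambda>x. min (6 * (Z N k x)\<^sup>2) (\<bar>?s\<bar> * \<bar>Z N k x\<bar> ^ 3))"
        by (rule char_approx3'[OF _ i1 i2 mean[OF k] _ refl]) (use mean[OF k] var[OF k] in auto)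
      also have "expectation (\<lambda>x. min (6 * (Z N k x)\<^sup>2) (\<bar>?s\<bar> * \<bar>Z N k x\<bar> ^ 3)) \<le> expectation (\<lambda>x. \<bar>?s\<bar> * B ^ 3)"
      proof (rule integral_mono)
        show "integrable (M N) (\<lambda>x. min (6 * (Z N k x)\<^sup>2) (\<bar>?s\<bar> * \<bar>Z N k x\<bar> ^ 3))"
          by (rule Bochner_Integration.integrable_bound[OF integrable_mult_right[OF i2, of 6]]) auto
        fix x assume "x \<in> space (M N)"
        then have "\<bar>?s\<bar> * \<bar>Z N k x\<bar> ^ 3 \<le> \<bar>?s\<bar> * B ^ 3"
          using bound[OF k] by (intro mult_left_mono power_mono) auto
        then show "min (6 * (Z N k x)\<^sup>2) (\<bar>?s\<bar> * \<bar>Z N k x\<bar> ^ 3) \<le> \<bar>?s\<bar> * B ^ 3" by linarith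
      qed simp
      also have "\<dots> = \<bar>?s\<bar> * B ^ 3" by (simp add: prob_space)
      finally have "norm (char (distr (M N) borel (Z N k)) ?s - (1 - ?s\<^sup>2 * v / 2)) \<le> ?s\<^sup>2 / 6 * (\<bar>?s\<bar> * B ^ 3)"
        by (simp add: mult_left_mono)
      moreover have "?s\<^sup>2 / 6 * (\<bar>?s\<bar> * B ^ 3) = \<bar>?s\<bar> ^ 3 * B ^ 3 / 6"
        by (simp add: power3_eq_cube power2_eq_square abs_mult_self_eq)
      moreover have "1 - ?s\<^sup>2 * v / 2 = ?a N" using Npos by (simp add: power_divide)
      ultimately show ?thesis by (metis of_real_1 of_real_diff)
    qed
    \<comment> \<open>The condition \<open>N \<ge> t^2 v / 4\<close> is what keeps
      \<open>1 - t^2 v / (2 N)\<close> above -1, as the product estimate requires.\<close>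
    have a1: "\<bar>?a N\<bar> \<le> 1"
    proof -
      have "t\<^sup>2 * v / 2 / real N \<le> 2" "t\<^sup>2 * v / 2 / real N \<ge> 0"
        using N Npos v by (auto simp: field_simps)
      then show ?thesis by simp
    qed
    have "norm (\<phi> N - of_real (?a N ^ N))
      = norm ((\<Prod>k=1..N. char (distr (M N) borel (Z N k)) ?s) - (\<Prod>k=1..N. of_real (?a N)))"
      by (simp add: \<phi>)
    also have "\<dots> \<le> (\<Sum>k=1..N. norm (char (distr (M N) borel (Z N k)) ?s - of_real (?a N)))"
    proof (rule norm_prod_diff)
      show "norm (char (distr (M N) borel (Z N k)) ?s) \<le> 1" if "k \<in> {1..N}" for k
        using rv[OF that] by (intro real_distribution.cmod_char_le_1 real_distribution_distr)
      show "norm (of_real (?a N) :: complex) \<le> 1" using a1 by (simp only: norm_of_real)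
    qed
    also have "\<dots> \<le> (\<Sum>k=1..N. \<bar>?s\<bar> ^ 3 * B ^ 3 / 6)" by (rule sum_mono) (rule each)
    also have "\<dots> = real N * (\<bar>t\<bar> ^ 3 / (real N * sqrt (real N)) * B ^ 3 / 6)"
      using Npos by (simp add: power_divide power3_eq_cube)
    also have "\<dots> = (\<bar>t\<bar> ^ 3 * B ^ 3 / 6) / sqrt (real N)" using Npos by (simp add: field_simps)
    finally show ?thesis .
  qed
  have "(\<lambda>N. (\<bar>t\<bar> ^ 3 * B ^ 3 / 6) / sqrt (real N)) \<longlonglongrightarrow> 0"
    by (intro tendsto_divide_0[OF tendsto_const] filterlim_at_top_imp_at_infinity
        filterlim_compose[OF sqrt_at_top filterlim_real_sequentially])
  moreover have "eventually (\<lambda>N. norm (\<phi> N - of_real (?a N ^ N)) \<le> (\<bar>t\<bar> ^ 3 * B ^ 3 / 6) / sqrt (real N)) sequentially"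
    using eventually_ge_at_top[of "max 1 (nat \<lceil>t\<^sup>2 * v / 4\<rceil>)"]
    by eventually_elim (rule main, auto simp: nat_ceiling_le_eq)
  ultimately have "(\<lambda>N. \<phi> N - of_real (?a N ^ N)) \<longlonglongrightarrow> 0" by (rule Lim_null_comparison[rotated])
  moreover have "(\<lambda>N. complex_of_real (?a N ^ N)) \<longlonglongrightarrow> complex_of_real (exp (- (t\<^sup>2 * v) / 2))"
    by (rule isCont_tendsto_compose [OF _ tendsto_exp_limit_sequentially]) auto
  ultimately show ?thesis unfolding \<phi>_def[symmetric] by (rule Lim_transform[rotated])
qed

text \<open>The map \<open>x \<mapsto> iexp (t * x)\<close> has modulus 1 and is Lipschitz with
  constant \<open>|t|\<close>. Where \<open>U\<close> and \<open>V\<close> are within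
  \<open>\<epsilon>\<close> the integrands differ by at most \<open>|t| * \<epsilon>\<close>,
  elsewhere by at most 2, and the latter event has vanishing probability.\<close>

lemma char_tendsto_Slutsky:
  fixes M :: "nat \<Rightarrow> 'a measure" and U V :: "nat \<Rightarrow> 'a \<Rightarrow> real"
  assumes prob: "\<And>N. prob_space (M N)"
    and U [measurable]: "\<And>N. U N \<in> borel_measurable (M N)"
    and V [measurable]: "\<And>N. V N \<in> borel_measurable (M N)"
    and lim: "(\<lambda>N. char (distr (M N) borel (U N)) t) \<longlonglongrightarrow> c"
    and diff: "\<And>\<epsilon>. \<epsilon> > 0 \<Longrightarrow>
      (\<lambda>N. measure (M N) {\<omega> \<in> space (M N). \<bar>V N \<omega> - U N \<omega>\<bar> > \<epsilon>}) \<longlonglongrightarrow> 0"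
  shows "(\<lambda>N. char (distr (M N) borel (V N)) t) \<longlonglongrightarrow> c"
proof -
  have main: "norm (char (distr (M N) borel (V N)) t - char (distr (M N) borel (U N)) t)
      \<le> \<bar>t\<bar> * \<epsilon> + 2 * measure (M N) {\<omega> \<in> space (M N). \<bar>V N \<omega> - U N \<omega>\<bar> > \<epsilon>}" if "\<epsilon> > 0" for \<epsilon> N
  proof -
    interpret prob_space "M N" by (rule prob)
    let ?E = "{\<omega> \<in> space (M N). \<bar>V N \<omega> - U N \<omega>\<bar> > \<epsilon>}"
    have int: "integrable (M N) (\<lambda>\<omega>. iexp (t * W \<omega>))" if [measurable]: "W \<in> borel_measurable (M N)" for W
      by (rule integrable_const_bound[where B = 1]) auto
    have "char (distr (M N) borel (V N)) t - char (distr (M N) borel (U N)) t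
      = (\<integral>\<omega>. iexp (t * V N \<omega>) - iexp (t * U N \<omega>) \<partial>M N)"
      unfolding char_def by (subst Bochner_Integration.integral_diff[OF int[OF V] int[OF U]]) (simp add: integral_distr)
    then have "norm (char (distr (M N) borel (V N)) t - char (distr (M N) borel (U N)) t)
      = norm (\<integral>\<omega>. iexp (t * V N \<omega>) - iexp (t * U N \<omega>) \<partial>M N)" by simp
    also have "\<dots> \<le> (\<integral>\<omega>. \<bar>t\<bar> * \<epsilon> + 2 * indicator ?E \<omega> \<partial>M N)"
    proof (rule order_trans[OF integral_norm_bound integral_mono])
      show "integrable (M N) (\<lambda>\<omega>. norm (iexp (t * V N \<omega>) - iexp (t * U N \<omega>)))"
        by (intro integrable_norm Bochner_Integration.integrable_diff int U V)
      show "integrable (M N) (\<lambda>\<omega>. \<bar>t\<bar> * \<epsilon> + 2 * indicator ?E \<omega>)"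
        by (intro Bochner_Integration.integrable_add integrable_mult_right integrable_real_indicator integrable_const)
          (auto simp: emeasure_eq_measure)
      fix \<omega> assume \<omega>: "\<omega> \<in> space (M N)"
      have e: "iexp (t * V N \<omega>) = iexp (t * U N \<omega>) * iexp (t * (V N \<omega> - U N \<omega>))"
        by (simp add: exp_add[symmetric] algebra_simps)
      have n: "norm (iexp (t * V N \<omega>) - iexp (t * U N \<omega>)) = norm (iexp (t * (V N \<omega> - U N \<omega>)) - 1)"
      proof -
        have "iexp (t * V N \<omega>) - iexp (t * U N \<omega>) = iexp (t * U N \<omega>) * (iexp (t * (V N \<omega> - U N \<omega>)) - 1)"
          unfolding e by (simp add: algebra_simps)
        then show ?thesis by (simp only: norm_mult norm_exp_i_times mult_1)
      qed
      show "norm (iexp (t * V N \<omega>) - iexp (t * U N \<omega>)) \<le> \<bar>t\<bar> * \<epsilon> + 2 * indicator ?E \<omega>"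
      proof (cases "\<omega> \<in> ?E")
        case True
        have "norm (iexp (t * V N \<omega>) - iexp (t * U N \<omega>)) \<le> 1 + 1"
          by (rule order_trans[OF norm_triangle_ineq4]) (simp only: norm_exp_i_times order_refl)
        then show ?thesis using True \<open>\<epsilon> > 0\<close> by (simp add: add_increasing)
      next
        case False
        have "norm (iexp (t * (V N \<omega> - U N \<omega>)) - 1) \<le> \<bar>t * (V N \<omega> - U N \<omega>)\<bar>"
          using iexp_approx1[of "t * (V N \<omega> - U N \<omega>)" 0] by simp
        also have "\<dots> \<le> \<bar>t\<bar> * \<epsilon>" using False \<omega> by (auto simp: abs_mult intro: mult_left_mono)
        finally show ?thesis using False n by simp
      qed
    qed
    also have "\<dots> = \<bar>t\<bar> * \<epsilon> + 2 * measure (M N) ?E"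
      by (subst Bochner_Integration.integral_add) (auto simp: prob_space emeasure_eq_measure intro!: integrable_mult_right integrable_real_indicator)
    finally show ?thesis .
  qed
  have "(\<lambda>N. char (distr (M N) borel (V N)) t - char (distr (M N) borel (U N)) t) \<longlonglongrightarrow> 0"
  proof (rule LIMSEQ_I)
    fix r :: real assume r: "r > 0"
    \<comment> \<open>The summand 1 guards against \<open>t = 0\<close>. Each half of the bound in
      \<open>main\<close> is given \<open>r / 2\<close>, so the exceptional probability must drop
      below \<open>r / 4\<close>.\<close>
    define \<epsilon> where "\<epsilon> = r / (2 * (\<bar>t\<bar> + 1))"
    have \<epsilon>: "\<epsilon> > 0" "\<bar>t\<bar> * \<epsilon> \<le> r / 2" using r by (auto simp: \<epsilon>_def field_simps)
    obtain N0 where N0: "\<And>N. N \<ge> N0 \<Longrightarrow> norm (measure (M N) {\<omega> \<in> space (M N). \<bar>V N \<omega> - U N \<omega>\<bar> > \<epsilon>}) < r / 4"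
      using LIMSEQ_D[OF diff[OF \<epsilon>(1)], of "r / 4"] r by auto
    show "\<exists>N0. \<forall>N\<ge>N0. norm (char (distr (M N) borel (V N)) t - char (distr (M N) borel (U N)) t - 0) < r"
    proof (intro exI allI impI)
      fix N assume "N \<ge> N0"
      then show "norm (char (distr (M N) borel (V N)) t - char (distr (M N) borel (U N)) t - 0) < r"
        using main[OF \<epsilon>(1), of N] N0[of N] \<epsilon>(2) by simp
    qed
  qed
  then show ?thesis using lim by (rule Lim_transform[rotated])
qed

section \<open>Counts and relative entropy\<close>

text \<open>Independence and centring annihilate the off-diagonal products; boundedness supplies
  every integrability condition.\<close>

lemma (in prob_space) expectation_sum_square_indep:
  fixes Z :: "'k \<Rightarrow> 'a \<Rightarrow> real"
  assumes indep: "indep_vars (\<lambda>_. borel) Z A" and A: "finite A"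
    and bound: "\<And>k \<omega>. k \<in> A \<Longrightarrow> \<omega> \<in> space M \<Longrightarrow> \<bar>Z k \<omega>\<bar> \<le> B"
    and mean: "\<And>k. k \<in> A \<Longrightarrow> expectation (Z k) = 0"
  shows "expectation (\<lambda>\<omega>. (\<Sum>k\<in>A. Z k \<omega>)\<^sup>2) = (\<Sum>k\<in>A. expectation (\<lambda>\<omega>. (Z k \<omega>)\<^sup>2))"
proof -
  have rv: "Z k \<in> borel_measurable M" if "k \<in> A" for k
    using indep that unfolding indep_vars_def2 by blast
  have int: "integrable M (Z k)" if "k \<in> A" for k
    using rv[OF that] bound[OF that] by (intro integrable_const_bound[where B = B] AE_I2) auto
  have int2: "integrable M (\<lambda>\<omega>. Z k \<omega> * Z l \<omega>)" if "k \<in> A" "l \<in> A" for k l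
  proof (rule integrable_const_bound[where B = "B * B"])
    show "AE \<omega> in M. norm (Z k \<omega> * Z l \<omega>) \<le> B * B"
    proof (rule AE_I2)
      fix \<omega> assume "\<omega> \<in> space M"
      then show "norm (Z k \<omega> * Z l \<omega>) \<le> B * B"
        using bound[OF that(1), of \<omega>] bound[OF that(2), of \<omega>] by (auto simp: abs_mult intro!: mult_mono)
    qed
    show "(\<lambda>\<omega>. Z k \<omega> * Z l \<omega>) \<in> borel_measurable M" using rv that by auto
  qed
  have cross: "expectation (\<lambda>\<omega>. Z k \<omega> * Z l \<omega>) = 0" if "k \<in> A" "l \<in> A" "k \<noteq> l" for k l
  proof -
    have "indep_vars (\<lambda>_. borel) Z {k, l}" by (rule indep_vars_subset[OF indep]) (use that in auto)
    then have "expectation (\<lambda>\<omega>. \<Prod>i\<in>{k, l}. Z i \<omega>) = (\<Prod>i\<in>{k, l}. expectation (Z i))"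
      by (intro indep_vars_lebesgue_integral) (use that int in auto)
    then show ?thesis using that mean by simp
  qed
  have "expectation (\<lambda>\<omega>. (\<Sum>k\<in>A. Z k \<omega>)\<^sup>2) = expectation (\<lambda>\<omega>. \<Sum>k\<in>A. \<Sum>l\<in>A. Z k \<omega> * Z l \<omega>)"
    by (simp add: power2_eq_square sum_product)
  also have "\<dots> = (\<Sum>k\<in>A. \<Sum>l\<in>A. expectation (\<lambda>\<omega>. Z k \<omega> * Z l \<omega>))"
    by (subst Bochner_Integration.integral_sum, use int2 in force)
       (intro sum.cong refl Bochner_Integration.integral_sum int2)
  also have "\<dots> = (\<Sum>k\<in>A. \<Sum>l\<in>A. if k = l then expectation (\<lambda>\<omega>. (Z k \<omega>)\<^sup>2) else 0)"
    using cross by (intro sum.cong refl) (auto simp: power2_eq_square)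
  also have "\<dots> = (\<Sum>k\<in>A. expectation (\<lambda>\<omega>. (Z k \<omega>)\<^sup>2))"
    using A by (simp add: sum.delta)
  finally show ?thesis .
qed

lemma (in prob_space) expectation_finite_valued:
  fixes f :: "'b \<Rightarrow> real"
  assumes X: "X \<in> M \<rightarrow>\<^sub>M count_space A" and A: "finite A"
  shows "expectation (\<lambda>\<omega>. f (X \<omega>)) = (\<Sum>i\<in>A. prob {\<omega> \<in> space M. X \<omega> = i} * f i)"
proof -
  have E: "{\<omega> \<in> space M. X \<omega> = i} \<in> events" if "i \<in> A" for i
  proof -
    have "X -` {i} \<inter> space M \<in> events" using X that by (intro measurable_sets[OF X]) auto
    also have "X -` {i} \<inter> space M = {\<omega> \<in> space M. X \<omega> = i}" by auto
    finally show ?thesis .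
  qed
  have "expectation (\<lambda>\<omega>. f (X \<omega>)) = expectation (\<lambda>\<omega>. \<Sum>i\<in>A. f i * indicator {\<omega> \<in> space M. X \<omega> = i} \<omega>)"
  proof (intro Bochner_Integration.integral_cong refl)
    fix \<omega> assume \<omega>: "\<omega> \<in> space M"
    then have "X \<omega> \<in> A" using measurable_space[OF X] by simp
    then show "f (X \<omega>) = (\<Sum>i\<in>A. f i * indicator {\<omega> \<in> space M. X \<omega> = i} \<omega>)"
      using A \<omega> by (simp add: indicator_def of_bool_def if_distrib[of "\<lambda>x. _ * x"] cong: if_cong)
  qed
  also have "\<dots> = (\<Sum>i\<in>A. expectation (\<lambda>\<omega>. f i * indicator {\<omega> \<in> space M. X \<omega> = i} \<omega>))"
    by (intro Bochner_Integration.integral_sum integrable_mult_right integrable_real_indicator E)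
      (auto simp: emeasure_eq_measure)
  also have "\<dots> = (\<Sum>i\<in>A. prob {\<omega> \<in> space M. X \<omega> = i} * f i)"
    using E by (intro sum.cong refl) (simp add: sets.Int_space_eq2)
  finally show ?thesis .
qed

text \<open>Double counting of pairs (datum, outcome). It rewrites a statistic that is linear in the
  counts as a sum over the independent data, the form in which the central limit theorem
  applies.\<close>

lemma sum_counts:
  fixes f :: "nat \<Rightarrow> real"
  assumes "\<And>k. k \<in> {1..N} \<Longrightarrow> X k \<omega> \<in> A" "finite A"
  shows "(\<Sum>i\<in>A. real (counts N X \<omega> i) * f i) = (\<Sum>k=1..N. f (X k \<omega>))"
proof -
  have "(\<Sum>k=1..N. f (X k \<omega>)) = (\<Sum>k=1..N. \<Sum>i\<in>A. of_bool (X k \<omega> = i) * f i)"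
    using assms by (intro sum.cong refl) (simp add: of_bool_def if_distrib[of "\<lambda>x. x * _"] cong: if_cong)
  also have "\<dots> = (\<Sum>i\<in>A. \<Sum>k=1..N. of_bool (X k \<omega> = i) * f i)" by (rule sum.swap)
  also have "\<dots> = (\<Sum>i\<in>A. real (counts N X \<omega> i) * f i)"
  proof (intro sum.cong refl)
    fix i
    have "(\<Sum>k=1..N. of_bool (X k \<omega> = i) :: real) = real (card {k \<in> {1..N}. X k \<omega> = i})"
      by (simp add: of_bool_def sum.If_cases Int_def)
    then show "(\<Sum>k=1..N. of_bool (X k \<omega> = i) * f i) = real (counts N X \<omega> i) * f i"
      by (simp add: sum_distrib_right[symmetric] counts_def)
  qed
  finally show ?thesis ..
qed

text \<open>\<open>R\<close> is the relative entropy of \<open>q\<close> with respect to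
  \<open>p\<close>. Both bounds come from \<open>ln x \<le> x - 1\<close>, applied to
  \<open>p i / q i\<close> for the lower and to \<open>q i / p i\<close> for the upper one; the
  linear parts \<open>q i - p i\<close> sum to 0. An index with \<open>q i = 0\<close> contributes 0
  to \<open>R\<close> and is checked separately.\<close>

lemma negentropy_linearization:
  fixes p q :: "'i \<Rightarrow> real"
  assumes p: "\<And>i. i \<in> I \<Longrightarrow> p i > 0" and q: "\<And>i. i \<in> I \<Longrightarrow> q i \<ge> 0"
    and sums: "sum p I = 1" "sum q I = 1"
  defines "R \<equiv> (\<Sum>i\<in>I. q i * ln (q i)) - (\<Sum>i\<in>I. q i * ln (p i))"
  shows "0 \<le> R" "R \<le> (\<Sum>i\<in>I. (q i - p i)\<^sup>2 / p i)"
proof -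
  have R: "R = (\<Sum>i\<in>I. q i * ln (q i) - q i * ln (p i))" by (simp add: R_def sum_subtractf)
  have lo: "q i - p i \<le> q i * ln (q i) - q i * ln (p i)"
    and hi: "q i * ln (q i) - q i * ln (p i) \<le> (q i - p i)\<^sup>2 / p i + (q i - p i)" if i: "i \<in> I" for i
  proof -
    have sq: "(q i - p i)\<^sup>2 / p i + (q i - p i) = q i * (q i / p i - 1)"
      using p[OF i] by (simp add: field_simps power2_eq_square)
    show "q i - p i \<le> q i * ln (q i) - q i * ln (p i)"
    proof (cases "q i = 0")
      case False
      with q[OF i] have qi: "q i > 0" by simp
      have "q i * ln (p i / q i) \<le> q i * (p i / q i - 1)"
        using p[OF i] qi by (intro mult_left_mono ln_le_minus_one) auto
      then show ?thesis using p[OF i] qi by (simp add: ln_div algebra_simps)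
    qed (use p[OF i] in simp)
    show "q i * ln (q i) - q i * ln (p i) \<le> (q i - p i)\<^sup>2 / p i + (q i - p i)"
    proof (cases "q i = 0")
      case False
      with q[OF i] have qi: "q i > 0" by simp
      have "q i * ln (q i / p i) \<le> q i * (q i / p i - 1)"
        using p[OF i] qi by (intro mult_left_mono ln_le_minus_one) auto
      then show ?thesis unfolding sq using p[OF i] qi by (simp add: ln_div algebra_simps)
    qed (use p[OF i] in \<open>simp add: power2_eq_square\<close>)
  qed
  have z: "(\<Sum>i\<in>I. q i - p i) = 0" using sums by (simp add: sum_subtractf)
  show "0 \<le> R" unfolding R z[symmetric] by (rule sum_mono) (rule lo)
  have "R \<le> (\<Sum>i\<in>I. (q i - p i)\<^sup>2 / p i + (q i - p i))" unfolding R by (rule sum_mono) (rule hi)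
  then show "R \<le> (\<Sum>i\<in>I. (q i - p i)\<^sup>2 / p i)" by (simp add: sum.distrib z)
qed

text \<open>Covariances with the constant \<open>1\<close> vanish, so the summand \<open>1\<close> in \<open>1 + ln pbar\<^sub>i\<close> has no effect.\<close>

lemma sum_multinomial_cov:
  assumes "sum p {1..n} = 1"
  shows "(\<Sum>i=1..n. \<Sum>j=1..n. (1 + l i) * (1 + l j) * multinomial_cov p i j)
    = (\<Sum>i=1..n. p i * (l i - (\<Sum>j=1..n. p j * l j))\<^sup>2)"
proof -
  let ?h = "\<Sum>j=1..n. p j * l j" and ?w = "\<lambda>i. 1 + l i"
  have "(\<Sum>j=1..n. ?w i * ?w j * multinomial_cov p i j) = p i * (?w i)\<^sup>2 - p i * ?w i * (1 + ?h)"
    if i: "i \<in> {1..n}" for i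
  proof -
    have "(\<Sum>j=1..n. ?w i * ?w j * multinomial_cov p i j)
      = (\<Sum>j=1..n. (if j = i then p i * (?w i)\<^sup>2 else 0) - p i * ?w i * (p j + p j * l j))"
      by (intro sum.cong refl) (auto simp: multinomial_cov_def algebra_simps power2_eq_square)
    also have "\<dots> = p i * (?w i)\<^sup>2 - p i * ?w i * (\<Sum>j=1..n. p j + p j * l j)"
      using i by (simp add: sum_subtractf sum_distrib_left[symmetric])
    finally show ?thesis using assms by (simp add: sum.distrib)
  qed
  then have "(\<Sum>i=1..n. \<Sum>j=1..n. ?w i * ?w j * multinomial_cov p i j)
    = (\<Sum>i=1..n. p i * (?w i)\<^sup>2 - p i * ?w i * (1 + ?h))" by (intro sum.cong refl) blast
  also have "\<dots> = (\<Sum>i=1..n. p i * (l i - ?h)\<^sup>2 + (1 + ?h) * (p i * l i - p i * ?h))"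
    by (intro sum.cong refl) (simp add: algebra_simps power2_eq_square)
  also have "\<dots> = (\<Sum>i=1..n. p i * (l i - ?h)\<^sup>2)"
    using assms by (simp add: sum.distrib sum_distrib_left[symmetric] sum_subtractf sum_distrib_right[symmetric])
  finally show ?thesis .
qed

text \<open>The counts depend on the sample point only through the finite data vector, which takes
  values in a discrete space. Hence an arbitrary function of the counts, such as the threshold
  \<open>\<gamma>\<close>, is a random variable.\<close>

lemma measurable_counts:
  assumes "\<And>k. k \<in> {1..N} \<Longrightarrow> X k \<in> M \<rightarrow>\<^sub>M count_space A" "countable A"
  shows "(\<lambda>\<omega>. f (counts N X \<omega>)) \<in> M \<rightarrow>\<^sub>M borel"
proof -
  have 1: "(\<lambda>\<omega>. \<lambda>k\<in>{1..N}. X k \<omega>) \<in> M \<rightarrow>\<^sub>M count_space (PiE {1..N} (\<lambda>_. A))"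
    unfolding count_space_PiM_finite[OF finite_atLeastAtMost assms(2), symmetric]
    by (rule measurable_restrict) (rule assms(1))
  have "(\<lambda>y. f (\<lambda>i. card {k \<in> {1..N}. y k = i})) \<in> count_space (PiE {1..N} (\<lambda>_. A)) \<rightarrow>\<^sub>M borel" by simp
  from measurable_compose[OF 1 this] show ?thesis
    by (rule back_subst[of "\<lambda>g. g \<in> M \<rightarrow>\<^sub>M borel"])
       (auto intro!: ext arg_cong[where f = f] arg_cong[where f = card] simp: counts_def)
qed

text \<open>The deviation of each count is a sum of \<open>N\<close> independent centred indicators,
  of variance \<open>N * p i * (1 - p i)\<close>. Dividing by \<open>N^2 * p i\<close> leaves
  \<open>(1 - p i) / N\<close>, which is at most \<open>1 / N\<close>.\<close>

lemma (in prob_space) expectation_counts_chi_square: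
  assumes indep: "indep_vars (\<lambda>_. count_space {1..n}) X {1..N}"
    and law: "\<And>k i. k \<in> {1..N} \<Longrightarrow> i \<in> {1..n} \<Longrightarrow> prob {\<omega> \<in> space M. X k \<omega> = i} = p i"
    and p: "\<And>i. i \<in> {1..n} \<Longrightarrow> p i > 0" and psum: "sum p {1..n} = 1" and N: "N > 0"
  defines "Q \<equiv> \<lambda>\<omega>. \<Sum>i=1..n. (real (counts N X \<omega> i) / real N - p i)\<^sup>2 / p i"
  shows "integrable M Q" "expectation Q \<le> real n / real N"
proof -
  have X: "X k \<in> M \<rightarrow>\<^sub>M count_space {1..n}" if "k \<in> {1..N}" for k
    using indep that unfolding indep_vars_def2 by blast
  have le1: "p i \<le> 1" if "i \<in> {1..n}" for i
  proof -
    have "sum p {i} \<le> sum p {1..n}" by (rule sum_mono2) (use that in \<open>auto intro!: less_imp_le[OF p]\<close>)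
    then show ?thesis using psum by simp
  qed
  define W where "W i k \<omega> = of_bool (X k \<omega> = i) - p i" for i k \<omega>
  have dev: "real (counts N X \<omega> i) / real N - p i = (\<Sum>k=1..N. W i k \<omega>) / real N" for i \<omega>
  proof -
    have "(\<Sum>k=1..N. of_bool (X k \<omega> = i) :: real) = real (counts N X \<omega> i)"
      by (simp add: of_bool_def sum.If_cases Int_def counts_def)
    then show ?thesis using N by (simp add: W_def sum_subtractf field_simps)
  qed
  have Wm: "W i k \<in> borel_measurable M" if "k \<in> {1..N}" for i k
    unfolding W_def[abs_def] by (rule measurable_compose[OF X[OF that]]) simp
  have Wb: "\<bar>W i k \<omega>\<bar> \<le> 1" if "i \<in> {1..n}" for i k \<omega>
    using p[OF that] le1[OF that] by (auto simp: W_def)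
  have sq: "expectation (\<lambda>\<omega>. (\<Sum>k=1..N. W i k \<omega>)\<^sup>2) = real N * (p i * (1 - p i))" if i: "i \<in> {1..n}" for i
  proof -
    have E: "expectation (\<lambda>\<omega>. g (X k \<omega>)) = (\<Sum>j=1..n. p j * g j)" if "k \<in> {1..N}" for k and g :: "nat \<Rightarrow> real"
      using expectation_finite_valued[OF X[OF that], of g] law[OF that] by simp
    have sel: "(\<Sum>j=1..n. p j * (of_bool (j = i) * u)) = p i * u" for u
      using i by (simp add: of_bool_def if_distrib[of "\<lambda>x. x * _"] if_distrib[of "\<lambda>x. _ * x"] cong: if_cong)
    have "expectation (\<lambda>\<omega>. (\<Sum>k=1..N. W i k \<omega>)\<^sup>2) = (\<Sum>k=1..N. expectation (\<lambda>\<omega>. (W i k \<omega>)\<^sup>2))"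
    proof (rule expectation_sum_square_indep)
      show "indep_vars (\<lambda>_. borel) (W i) {1..N}"
        unfolding W_def[abs_def]
        by (rule indep_vars_compose2[OF indep, where Y = "\<lambda>_ x. of_bool (x = i) - p i"]) simp
      show "expectation (W i k) = 0" if "k \<in> {1..N}" for k
      proof -
        have "expectation (W i k) = (\<Sum>j=1..n. p j * (of_bool (j = i) * 1) - p j * p i)"
          unfolding W_def[abs_def] by (subst E[OF that]) (simp add: algebra_simps)
        also have "\<dots> = 0" unfolding sum_subtractf sel using psum by (simp add: sum_distrib_right[symmetric])
        finally show ?thesis .
      qed
    qed (use Wb[OF i] in auto)
    also have "\<dots> = (\<Sum>k=1..N. p i * (1 - p i))"
    proof (intro sum.cong refl)
      fix k assume k: "k \<in> {1..N}"
      \<comment> \<open>An indicator equals its own square, so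
        \<open>(of_bool b - p)^2 = of_bool b * (1 - 2 * p) + p^2\<close>; this is the shape that
        \<open>sel\<close> evaluates.\<close>
      have "expectation (\<lambda>\<omega>. (W i k \<omega>)\<^sup>2) = (\<Sum>j=1..n. p j * (of_bool (j = i) * (1 - 2 * p i)) + p j * (p i)\<^sup>2)"
        unfolding W_def by (subst E[OF k]) (intro sum.cong refl, auto simp: power2_eq_square algebra_simps)
      also have "\<dots> = p i * (1 - p i)"
        unfolding sum.distrib sel using psum by (simp add: sum_distrib_right[symmetric] power2_eq_square algebra_simps)
      finally show "expectation (\<lambda>\<omega>. (W i k \<omega>)\<^sup>2) = p i * (1 - p i)" .
    qed
    finally show ?thesis by simp
  qed
  have int: "integrable M (\<lambda>\<omega>. (\<Sum>k=1..N. W i k \<omega>)\<^sup>2)" if i: "i \<in> {1..n}" for i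
  proof (rule integrable_const_bound[where B = "(real N)\<^sup>2"])
    show "AE \<omega> in M. norm ((\<Sum>k=1..N. W i k \<omega>)\<^sup>2) \<le> (real N)\<^sup>2"
    proof (rule AE_I2)
      fix \<omega>
      have "\<bar>\<Sum>k=1..N. W i k \<omega>\<bar> \<le> (\<Sum>k=1..N. 1)"
        by (rule order_trans[OF sum_abs sum_mono]) (rule Wb[OF i])
      then show "norm ((\<Sum>k=1..N. W i k \<omega>)\<^sup>2) \<le> (real N)\<^sup>2"
        by (simp add: abs_le_square_iff[symmetric])
    qed
    show "(\<lambda>\<omega>. (\<Sum>k=1..N. W i k \<omega>)\<^sup>2) \<in> borel_measurable M" using Wm by simp
  qed
  have Q: "Q = (\<lambda>\<omega>. \<Sum>i=1..n. (1 / ((real N)\<^sup>2 * p i)) * (\<Sum>k=1..N. W i k \<omega>)\<^sup>2)"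
    unfolding Q_def dev by (simp add: power_divide)
  show "integrable M Q" unfolding Q by (intro Bochner_Integration.integrable_sum integrable_mult_right int)
  have "expectation Q = (\<Sum>i=1..n. (1 / ((real N)\<^sup>2 * p i)) * (real N * (p i * (1 - p i))))"
    unfolding Q
  proof (subst Bochner_Integration.integral_sum)
    show "(\<Sum>i=1..n. expectation (\<lambda>\<omega>. 1 / ((real N)\<^sup>2 * p i) * (\<Sum>k=1..N. W i k \<omega>)\<^sup>2))
      = (\<Sum>i=1..n. (1 / ((real N)\<^sup>2 * p i)) * (real N * (p i * (1 - p i))))"
      by (intro sum.cong refl) (simp only: integral_mult_right_zero sq)
  qed (intro integrable_mult_right int)
  also have "\<dots> \<le> (\<Sum>i=1..n. 1 / real N)"
  proof (rule sum_mono)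
    fix i assume "i \<in> {1..n}"
    then have "p i > 0" by (rule p)
    then show "1 / ((real N)\<^sup>2 * p i) * (real N * (p i * (1 - p i))) \<le> 1 / real N"
      using N by (simp add: field_simps power2_eq_square)
  qed
  finally show "expectation Q \<le> real n / real N" by simp
qed

text \<open>The deterministic core: for counts with small chi-square distance from \<open>p\<close>
  and large \<open>N\<close>, replacing \<open>\<gamma> / N\<close> by the linear statistic costs at
  most \<open>\<epsilon> / sqrt N\<close>. Probability enters later, only through the chance that
  the chi-square distance is small.\<close>

lemma threshold_remainder_bound:
  fixes c :: "nat \<Rightarrow> nat" and p :: "nat \<Rightarrow> real"
  assumes p: "\<And>i. i \<in> {1..n} \<Longrightarrow> p i \<ge> \<delta>" and \<delta>: "\<delta> > 0" and psum: "sum p {1..n} = 1"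
    and \<alpha>: "0 < \<alpha>" "\<alpha> < 1" and \<epsilon>: "\<epsilon> > 0"
    and csum: "(\<Sum>i=1..n. c i) = N"
    and meas: "(\<forall>i\<in>{1..n}. c i > 0) \<Longrightarrow>
      measure (dirichlet n (\<lambda>i. real (c i))) (likelihood_region n c \<gamma>) = 1 - \<alpha>"
    and N: "N > 0" "2 * real n < \<alpha> * (\<epsilon> * sqrt (real N))" "4 * \<epsilon> / \<delta> \<le> sqrt (real N)" "4 / \<delta> \<le> real N"
    and chi: "(\<Sum>i=1..n. (real (c i) / real N - p i)\<^sup>2 / p i) < \<epsilon> / sqrt (real N)"
  shows "\<bar>sqrt (real N) * (\<gamma> / real N - (\<Sum>i=1..n. real (c i) / real N * ln (p i)))\<bar> \<le> \<epsilon>"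
proof -
  let ?q = "\<lambda>i. real (c i) / real N"
  have Npos: "real N > 0" "sqrt (real N) > 0" using N by auto
  have ppos: "p i > 0" if "i \<in> {1..n}" for i using p[OF that] \<delta> by linarith
  have n: "n \<ge> 1" using psum by (cases n) auto
  \<comment> \<open>The chi-square bound and
    \<open>\<epsilon> / sqrt N \<le> \<delta> / 4 \<le> p i / 4\<close> force
    \<open>|q i - p i| < p i / 2\<close>. So \<open>c i > N * p i / 2\<close>, which is at least
    \<open>(4 / \<delta>) * (\<delta> / 2) = 2\<close>; this explains both constants 4 in the size
    conditions.\<close>
  have c2: "c i \<ge> 2" if i: "i \<in> {1..n}" for i
  proof -
    have "(?q i - p i)\<^sup>2 / p i \<le> (\<Sum>i=1..n. (?q i - p i)\<^sup>2 / p i)"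
      using i by (intro member_le_sum) (auto intro!: divide_nonneg_pos ppos)
    with chi have "(?q i - p i)\<^sup>2 / p i < \<epsilon> / sqrt (real N)" by linarith
    then have "(?q i - p i)\<^sup>2 < \<epsilon> / sqrt (real N) * p i" using ppos[OF i] by (simp add: pos_divide_less_eq)
    also have "\<epsilon> / sqrt (real N) \<le> \<delta> / 4" using N(3) \<delta> Npos by (simp add: field_simps)
    then have "\<epsilon> / sqrt (real N) * p i \<le> p i / 4 * p i"
      using p[OF i] ppos[OF i] by (intro mult_right_mono) auto
    also have "p i / 4 * p i = (p i / 2)\<^sup>2" by (simp add: power2_eq_square)
    finally have "\<bar>?q i - p i\<bar>\<^sup>2 < (p i / 2)\<^sup>2" by simp
    then have "\<bar>?q i - p i\<bar> < p i / 2" by (rule power2_less_imp_less) (use ppos[OF i] in simp)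
    then have "?q i > p i / 2" using ppos[OF i] by linarith
    then have "real (c i) > real N * (p i / 2)" using Npos by (simp add: field_simps)
    moreover have "real N * (p i / 2) \<ge> (4 / \<delta>) * (\<delta> / 2)"
      using N(4) p[OF i] \<delta> by (intro mult_mono) auto
    ultimately have "real (c i) > 2" using \<delta> by simp
    then show ?thesis by simp
  qed
  have m: "measure (dirichlet n (\<lambda>i. real (c i))) (likelihood_region n c \<gamma>) = 1 - \<alpha>"
    using c2 by (intro meas) force
  \<comment> \<open>The deviation is taken as \<open>t = \<epsilon> * sqrt N\<close>, which becomes
    \<open>\<epsilon> / sqrt N\<close> after division by \<open>N\<close>.\<close>
  note b = likelihood_threshold_bounds[OF n c2 csum \<alpha> m N(2)]
  have H: "(\<Sum>i=1..n. real (c i) * ln (?q i)) = real N * (\<Sum>i=1..n. ?q i * ln (?q i))"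
    using Npos by (simp add: sum_distrib_left)
  have qsum: "sum ?q {1..n} = 1"
    using Npos csum by (simp add: sum_divide_distrib[symmetric] flip: of_nat_sum)
  define R where "R = (\<Sum>i=1..n. ?q i * ln (?q i)) - (\<Sum>i=1..n. ?q i * ln (p i))"
  have "0 \<le> R" "R \<le> (\<Sum>i=1..n. (?q i - p i)\<^sup>2 / p i)"
    unfolding R_def by (rule negentropy_linearization[OF ppos _ psum qsum]; simp)+
  with chi have R: "0 \<le> R" "R \<le> \<epsilon> / sqrt (real N)" by linarith+
  let ?G = "\<gamma> / real N - (\<Sum>i=1..n. ?q i * ln (?q i))"
  have sN: "real N = sqrt (real N) * sqrt (real N)" by simp
  have G: "- (\<epsilon> / sqrt (real N)) \<le> ?G" "?G \<le> 0"
  proof -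
    have "real N * (\<Sum>i=1..n. ?q i * ln (?q i)) - \<epsilon> * sqrt (real N) \<le> \<gamma>" using b(1) H by simp
    then have "(real N * (\<Sum>i=1..n. ?q i * ln (?q i)) - \<epsilon> * sqrt (real N)) / real N \<le> \<gamma> / real N"
      using Npos by (intro divide_right_mono) auto
    moreover have "\<epsilon> * sqrt (real N) / real N = \<epsilon> / sqrt (real N)"
      using Npos by (subst (2) sN) (simp del: real_sqrt_mult_self)
    ultimately show "- (\<epsilon> / sqrt (real N)) \<le> ?G" using Npos by (simp add: diff_divide_distrib)
    have "\<gamma> / real N \<le> real N * (\<Sum>i=1..n. ?q i * ln (?q i)) / real N"
      using b(2) H Npos by (intro divide_right_mono) auto
    then show "?G \<le> 0" using Npos by simp
  qed
  \<comment> \<open>The two errors have opposite signs, so each may be as large as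
    \<open>\<epsilon> / sqrt N\<close> without their sum exceeding it in modulus.\<close>
  have "\<bar>?G + R\<bar> \<le> \<epsilon> / sqrt (real N)" using R G by linarith
  then have "sqrt (real N) * \<bar>?G + R\<bar> \<le> sqrt (real N) * (\<epsilon> / sqrt (real N))"
    using Npos by (intro mult_left_mono) auto
  also have "\<dots> = \<epsilon>" using Npos by simp
  finally show ?thesis unfolding R_def using Npos by (simp add: abs_mult)
qed

section \<open>Passage to the limit: comparison of the threshold with a normalized sum of
  independent terms\<close>

theorem theorem2:
  fixes n :: nat and pbar :: "nat \<Rightarrow> real" and \<alpha> :: real
    and M :: "nat \<Rightarrow> 'a measure" and X :: "nat \<Rightarrow> nat \<Rightarrow> 'a \<Rightarrow> nat"
    and \<gamma> :: "(nat \<Rightarrow> nat) \<Rightarrow> real"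
    and M' :: "'b measure" and Y :: "nat \<Rightarrow> 'b \<Rightarrow> real"
  assumes pbar_pos: "\<And>i. i \<in> {1..n} \<Longrightarrow> pbar i > 0"
    and pbar_sum: "(\<Sum>i=1..n. pbar i) = 1"
    and alpha: "0 < \<alpha>" "\<alpha> < 1"
    and prob: "\<And>N. prob_space (M N)"
    and indep: "\<And>N. prob_space.indep_vars (M N) (\<lambda>_. count_space {1..n}) (X N) {1..N}"
    and law: "\<And>N k i. k \<in> {1..N} \<Longrightarrow> i \<in> {1..n} \<Longrightarrow>
                measure (M N) {\<omega> \<in> space (M N). X N k \<omega> = i} = pbar i"
    and gamma: "\<And>N \<omega>. \<omega> \<in> space (M N) \<Longrightarrow> (\<forall>i\<in>{1..n}. counts N (X N) \<omega> i > 0) \<Longrightarrow>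
                  measure (dirichlet n (\<lambda>i. real (counts N (X N) \<omega> i)))
                    (likelihood_region n (counts N (X N) \<omega>) (\<gamma> (counts N (X N) \<omega>))) = 1 - \<alpha>"
    and prob': "prob_space M'"
    and normal: "multivariate_normal M' n Y (\<lambda>_. 0) (multinomial_cov pbar)"
  shows "weak_conv_m
           (\<lambda>N. distr (M N) borel
              (\<lambda>\<omega>. sqrt (real N) *
                 (\<gamma> (counts N (X N) \<omega>) / real N - (\<Sum>i=1..n. pbar i * ln (pbar i)))))
           (distr M' borel (\<lambda>\<omega>. \<Sum>i=1..n. (1 + ln (pbar i)) * Y i \<omega>))"
proof -
  define h where "h = (\<Sum>i=1..n. pbar i * ln (pbar i))"
  define v where "v = (\<Sum>i=1..n. pbar i * (ln (pbar i) - h)\<^sup>2)"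
  \<comment> \<open>\<open>Z\<close> is the centred log-probability of one datum, so
    \<open>U\<close> is the linear statistic
    \<open>sqrt N * (\<Sum>i. (q i - pbar i) * ln (pbar i))\<close> with
    \<open>q i = N_i / N\<close>. \<open>V\<close> is the quantity whose limit is sought, and
    \<open>Q\<close> the chi-square distance that controls \<open>V - U\<close>.\<close>
  define Z where "Z N k \<omega> = ln (pbar (X N k \<omega>)) - h" for N k \<omega>
  define U where "U N \<omega> = (\<Sum>k=1..N. Z N k \<omega>) / sqrt (real N)" for N \<omega>
  define V where "V N \<omega> = sqrt (real N) * (\<gamma> (counts N (X N) \<omega>) / real N - h)" for N \<omega>
  define Q where "Q N \<omega> = (\<Sum>i=1..n. (real (counts N (X N) \<omega> i) / real N - pbar i)\<^sup>2 / pbar i)" for N \<omega>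
  have Xm: "X N k \<in> M N \<rightarrow>\<^sub>M count_space {1..n}" if "k \<in> {1..N}" for N k
    using indep[of N] that unfolding prob_space.indep_vars_def2[OF prob] by blast
  have Xin: "X N k \<omega> \<in> {1..n}" if "k \<in> {1..N}" "\<omega> \<in> space (M N)" for N k \<omega>
    using measurable_space[OF Xm[OF that(1)] that(2)] by simp
  have EX: "(\<integral>\<omega>. f (X N k \<omega>) \<partial>M N) = (\<Sum>i=1..n. pbar i * f i)" if "k \<in> {1..N}" for f :: "nat \<Rightarrow> real" and N k
    using prob_space.expectation_finite_valued[OF prob Xm[OF that], of f] law[OF that] by simp
  have Um: "U N \<in> borel_measurable (M N)" for N
    unfolding U_def[abs_def] Z_def
    by (intro borel_measurable_divide borel_measurable_sum borel_measurable_const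
        borel_measurable_diff measurable_compose[OF Xm]) simp_all
  have Vm: "V N \<in> borel_measurable (M N)" for N
    unfolding V_def[abs_def] by (rule measurable_counts[OF Xm]) auto
  have clt: "(\<lambda>N. char (distr (M N) borel (U N)) t) \<longlonglongrightarrow> exp (- (t\<^sup>2 * v) / 2)" for t
    unfolding U_def[abs_def]
  proof (rule char_bounded_array_tendsto[OF prob])
    show "prob_space.indep_vars (M N) (\<lambda>_. borel) (Z N) {1..N}" for N
      unfolding Z_def[abs_def]
      by (rule prob_space.indep_vars_compose2[OF prob indep, where Y = "\<lambda>_ x. ln (pbar x) - h"]) simp
    \<comment> \<open>The sum over all outcomes dominates its term at the observed outcome, which
      gives a bound uniform in \<open>N\<close> and \<open>k\<close>.\<close>
    show "\<bar>Z N k \<omega>\<bar> \<le> (\<Sum>i=1..n. \<bar>ln (pbar i) - h\<bar>)" if "k \<in> {1..N}" "\<omega> \<in> space (M N)" for N k \<omega>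
      unfolding Z_def using Xin[OF that] by (intro member_le_sum) auto
    show "(\<integral>\<omega>. Z N k \<omega> \<partial>M N) = 0" if "k \<in> {1..N}" for N k
      unfolding Z_def EX[OF that, of "\<lambda>i. ln (pbar i) - h"]
      using pbar_sum by (simp add: right_diff_distrib sum_subtractf sum_distrib_right[symmetric] h_def)
    show "(\<integral>\<omega>. (Z N k \<omega>)\<^sup>2 \<partial>M N) = v" if "k \<in> {1..N}" for N k
      unfolding Z_def EX[OF that, of "\<lambda>i. (ln (pbar i) - h)\<^sup>2"] v_def ..
  qed
  obtain \<delta> where \<delta>: "\<delta> > 0" "\<And>i. i \<in> {1..n} \<Longrightarrow> pbar i \<ge> \<delta>"
  proof
    have "{1..n} \<noteq> {}" using pbar_sum by (metis sum.empty zero_neq_one)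
    then show "Min (pbar ` {1..n}) > 0" using pbar_pos by (subst Min_gr_iff) auto
  qed auto
  \<comment> \<open>Markov's inequality bounds the probability by
    \<open>(n / N) / (\<epsilon> / sqrt N) = n / (\<epsilon> * sqrt N)\<close> for large
    \<open>N\<close>.\<close>
  have diff: "(\<lambda>N. measure (M N) {\<omega> \<in> space (M N). \<bar>V N \<omega> - U N \<omega>\<bar> > \<epsilon>}) \<longlonglongrightarrow> 0" if \<epsilon>: "\<epsilon> > 0" for \<epsilon>
  proof (rule tendsto_sandwich[OF _ _ tendsto_const])
    have s: "filterlim (\<lambda>N. sqrt (real N)) at_top sequentially"
      by (rule filterlim_compose[OF sqrt_at_top filterlim_real_sequentially])
    show "(\<lambda>N. (real n / \<epsilon>) / sqrt (real N)) \<longlonglongrightarrow> 0"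
      by (rule tendsto_divide_0[OF tendsto_const filterlim_at_top_imp_at_infinity[OF s]])
    \<comment> \<open>These are the size conditions of \<open>threshold_remainder_bound\<close>, the
      second one solved for \<open>sqrt N\<close>.\<close>
    have "eventually (\<lambda>N. N > 0 \<and> 2 * real n / (\<alpha> * \<epsilon>) < sqrt (real N) \<and> 4 * \<epsilon> / \<delta> \<le> sqrt (real N) \<and> 4 / \<delta> \<le> real N) sequentially"
      using filterlim_at_top_dense[THEN iffD1, OF s] filterlim_at_top[THEN iffD1, OF s]
        filterlim_at_top[THEN iffD1, OF filterlim_real_sequentially]
      by (intro eventually_conj eventually_gt_at_top) simp_all
    then show "eventually (\<lambda>N. measure (M N) {\<omega> \<in> space (M N). \<bar>V N \<omega> - U N \<omega>\<bar> > \<epsilon>} \<le> (real n / \<epsilon>) / sqrt (real N)) sequentially"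
    proof eventually_elim
      case (elim N)
      interpret prob_space "M N" by (rule prob)
      have N: "N > 0" "real N > 0" "sqrt (real N) > 0" using elim by auto
      have Nn: "2 * real n < \<alpha> * (\<epsilon> * sqrt (real N))" using elim \<epsilon> alpha by (simp add: pos_divide_less_eq mult_ac)
      note Qs = expectation_counts_chi_square[OF indep law pbar_pos pbar_sum N(1)]
      have Qm: "Q N \<in> borel_measurable (M N)"
        unfolding Q_def[abs_def] by (rule measurable_counts[OF Xm]) auto
      \<comment> \<open>By contraposition: where \<open>Q\<close> is below
        \<open>\<epsilon> / sqrt N\<close>, all counts are positive, the defining property of
        \<open>\<gamma>\<close> is available, and the remainder is at most
        \<open>\<epsilon>\<close>. Samples with an empty cell therefore fall into the event on the
        right, whatever value \<open>\<gamma>\<close> takes there.\<close>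
      have "{\<omega> \<in> space (M N). \<bar>V N \<omega> - U N \<omega>\<bar> > \<epsilon>} \<subseteq> {\<omega> \<in> space (M N). \<epsilon> / sqrt (real N) \<le> Q N \<omega>}"
      proof safe
        fix \<omega> assume \<omega>: "\<omega> \<in> space (M N)" and gt: "\<bar>V N \<omega> - U N \<omega>\<bar> > \<epsilon>"
        let ?c = "counts N (X N) \<omega>"
        have w: "(\<Sum>i=1..n. real (?c i) * f i) = (\<Sum>k=1..N. f (X N k \<omega>))" for f :: "nat \<Rightarrow> real"
          using Xin \<omega> by (intro sum_counts) auto
        have csum: "(\<Sum>i=1..n. ?c i) = N" using w[of "\<lambda>_. 1"] by (simp flip: of_nat_sum)
        have "U N \<omega> = ((\<Sum>i=1..n. real (?c i) * ln (pbar i)) - real N * h) / sqrt (real N)"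
          unfolding U_def Z_def w by (simp add: sum_subtractf)
        also have "\<dots> = sqrt (real N) * ((\<Sum>i=1..n. real (?c i) / real N * ln (pbar i)) - h)"
        proof -
          have "(a - real N * h) / sqrt (real N) = sqrt (real N) * (a / real N - h)" for a
          proof -
            have "a - real N * h = (sqrt (real N) * sqrt (real N)) * (a / real N - h)"
              using N by (simp add: right_diff_distrib)
            then show ?thesis using N by (simp del: real_sqrt_mult_self)
          qed
          then show ?thesis by (simp add: sum_divide_distrib)
        qed
        finally have "V N \<omega> - U N \<omega> = sqrt (real N) * (\<gamma> ?c / real N - (\<Sum>i=1..n. real (?c i) / real N * ln (pbar i)))"
          by (simp add: V_def algebra_simps)
        moreover have "\<bar>sqrt (real N) * (\<gamma> ?c / real N - (\<Sum>i=1..n. real (?c i) / real N * ln (pbar i)))\<bar> \<le> \<epsilon>"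
          if "Q N \<omega> < \<epsilon> / sqrt (real N)"
          using \<delta> pbar_sum alpha \<epsilon> csum gamma[OF \<omega>] N(1) Nn elim that unfolding Q_def
          by (intro threshold_remainder_bound[where \<delta> = \<delta> and \<alpha> = \<alpha>]) auto
        ultimately show "\<epsilon> / sqrt (real N) \<le> Q N \<omega>" using gt by linarith
      qed
      then have "prob {\<omega> \<in> space (M N). \<bar>V N \<omega> - U N \<omega>\<bar> > \<epsilon>} \<le> prob {\<omega> \<in> space (M N). \<epsilon> / sqrt (real N) \<le> Q N \<omega>}"
        using Qm by (intro finite_measure_mono) measurable
      also have "\<dots> \<le> expectation (Q N) / (\<epsilon> / sqrt (real N))"
        using Qs(1) \<epsilon> N pbar_pos unfolding Q_def[abs_def]
        by (intro integral_Markov_inequality_measure[where A = "{}"]) (auto intro!: AE_I2 sum_nonneg divide_nonneg_pos)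
      also have "\<dots> \<le> (real n / real N) / (\<epsilon> / sqrt (real N))"
        using Qs(2) \<epsilon> N unfolding Q_def[abs_def] by (intro divide_right_mono) auto
      also have "\<dots> = (real n / \<epsilon>) / sqrt (real N)"
      proof -
        have "real n * sqrt (real N) / (real N * \<epsilon>) = real n * sqrt (real N) / ((sqrt (real N) * sqrt (real N)) * \<epsilon>)" by simp
        also have "\<dots> = real n / \<epsilon> / sqrt (real N)" using N \<epsilon> by (simp del: real_sqrt_mult_self add: field_simps)
        finally show ?thesis by simp
      qed
      finally show ?case .
    qed
  qed (simp add: measure_nonneg)
  have Ym: "Y i \<in> borel_measurable M'" if "i \<in> {1..n}" for i
    using normal that unfolding multivariate_normal_def by blast
  show ?thesis
  proof (rule levy_continuity)
    show "real_distribution (distr (M N) borel (\<lambda>\<omega>. sqrt (real N) *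
        (\<gamma> (counts N (X N) \<omega>) / real N - (\<Sum>i=1..n. pbar i * ln (pbar i)))))" for N
      using Vm[of N] unfolding V_def[abs_def] h_def by (intro prob_space.real_distribution_distr prob)
    show "real_distribution (distr M' borel (\<lambda>\<omega>. \<Sum>i=1..n. (1 + ln (pbar i)) * Y i \<omega>))"
      using Ym by (intro prob_space.real_distribution_distr prob' borel_measurable_sum borel_measurable_times) auto
    show "(\<lambda>N. char (distr (M N) borel (\<lambda>\<omega>. sqrt (real N) *
        (\<gamma> (counts N (X N) \<omega>) / real N - (\<Sum>i=1..n. pbar i * ln (pbar i))))) t)
      \<longlonglongrightarrow> char (distr M' borel (\<lambda>\<omega>. \<Sum>i=1..n. (1 + ln (pbar i)) * Y i \<omega>)) t" for t
      \<comment> \<open>The quadratic form of the covariance in the weights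
        \<open>1 + ln (pbar i)\<close> equals \<open>v\<close>, the variance of a single
        \<open>Z\<close>, so the two Gaussian characteristic functions coincide.\<close>
      using char_tendsto_Slutsky[OF prob Um Vm clt diff, of t]
      unfolding char_distr_multivariate_normal_linear[OF normal] sum_multinomial_cov[OF pbar_sum]
        h_def[symmetric] v_def[symmetric] V_def[abs_def] .
  qed
qed

end
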